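(* Let $G=(V,E)$ be an arbitrary 3-regular graph and let $V_0\subset V$ be a 2-independent vertex set in $G$. Let $|\psi_G\rangle$ be the state prepared by the depth-1 ($p=1$) QAOA for MaxCut on $G$. Then there exist (classically efficiently computable) real constants $J(G,V_0)_{v_0,v_0'}$, indexed by pairs $\{v_0,v_0'\}\subset V_0$ and depending only on $G$, $V_0$ (and the QAOA parameters), such that for every $(\sigma_{v_0})_{v_0\in V_0}\in\{-1,1\}^{V_0}$, with $\Pi_\sigma:=\prod_{v_0\in V_0}\frac{1+\sigma_{v_0}Z_{v_0}}{2}$, $$\frac{\langle\psi_G|\Pi_\sigma H_{\mathrm{MaxCut}}(G)\Pi_\sigma|\psi_G\rangle}{\lVert \Pi_\sigma|\psi_G\rangle\rVert^2}=\langle\psi_G|H_{\mathrm{MaxCut}}(G)|\psi_G\rangle+\sum_{\{v_0,v_0'\}\subset V_0}J(G,V_0)_{v_0,v_0'}\,\sigma_{v_0}\sigma_{v_0'},$$ where the sum is over unordered pairs of distinct vertices of $V_0$. The couplings can be expressed as $$J(G,V_0)_{v_0,v_0'}=-\frac12\sum_{\substack{e=\{e_0,e_1\}\in E\\ d(v_0,e)\le 2,\ d(v_0',e)\le 2}}\langle\psi_G|Z_{e_0}Z_{e_1}Z_{v_0}Z_{v_0'}|\psi_G\rangle .$$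
   Context: Qubits are labelled by the vertices of $G$; $X_v,Z_v$ are Pauli operators on qubit $v$. A vertex set $V_0$ is 2-independent if any two distinct vertices of $V_0$ are at graph distance at least $3$. For a vertex $v$ and an edge $e=\{e_0,e_1\}$, $d(v,e):=\min(d_G(v,e_0),d_G(v,e_1))$ with $d_G$ the graph distance. The MaxCut operator is $H_{\mathrm{MaxCut}}(G)=\sum_{\{e_0,e_1\}\in E}\frac{1-Z_{e_0}Z_{e_1}}{2}$, whose value on a computational basis state is the number of satisfied (cut) edges. The depth-1 QAOA state with parameters $\beta,\gamma\in\mathbb{R}$ is $$|\psi_G\rangle=\exp\Big(-\tfrac{i\beta}{2}\sum_{v\in V}X_v\Big)\exp\Big(-\tfrac{i\gamma}{2}\sum_{\{e_0,e_1\}\in E}Z_{e_0}Z_{e_1}\Big)|+\rangle^{\otimes |V|}.$$ "Classically efficiently computable" means computable by a classical algorithm in time polynomial in $|V|$. *)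

theory Defs
  imports "HOL-Analysis.Analysis" "HOL-Computational_Algebra.Polynomial" "HOL-Library.Extended_Nat"
begin

section \<open>Graphs\<close>

definition cubic_graph :: "'a set \<Rightarrow> 'a set set \<Rightarrow> bool" where
  "cubic_graph V E \<longleftrightarrow>
     finite V \<and> (\<forall>e\<in>E. e \<subseteq> V \<and> card e = 2) \<and> (\<forall>v\<in>V. card {e \<in> E. v \<in> e} = 3)"

text \<open>The distance is the length of a shortest walk; it is \<open>\<infinity>\<close> (the infimum of the empty set)
  if there is none.\<close>

definition graph_dist :: "'a set set \<Rightarrow> 'a \<Rightarrow> 'a \<Rightarrow> enat" where
  "graph_dist E u v = (INF k \<in> {k. (u, v) \<in> {(a, b). {a, b} \<in> E} ^^ k}. enat k)"

definition edge_dist :: "'a set set \<Rightarrow> 'a \<Rightarrow> 'a set \<Rightarrow> enat" where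
  "edge_dist E v e = Min (graph_dist E v ` e)"

definition two_independent :: "'a set \<Rightarrow> 'a set set \<Rightarrow> 'a set \<Rightarrow> bool" where
  "two_independent V E V0 \<longleftrightarrow>
     V0 \<subseteq> V \<and> (\<forall>v\<in>V0. \<forall>w\<in>V0. v \<noteq> w \<longrightarrow> 3 \<le> graph_dist E v w)"


section \<open>States and operators\<close>

text \<open>A computational basis state of the qubits in \<open>V\<close> is a set \<open>x \<subseteq> V\<close>: the qubits in \<open>x\<close> are in
  state 1 (where \<open>Z\<close> has eigenvalue -1), the others in state 0. A state vector assigns an amplitude
  to every basis state; for qubits \<open>V\<close> only its values on \<open>Pow V\<close> matter.\<close>

type_synonym 'a ket = "'a set \<Rightarrow> complex"
type_synonym 'a oper = "'a ket \<Rightarrow> 'a ket"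

definition braket :: "'a set \<Rightarrow> 'a ket \<Rightarrow> 'a ket \<Rightarrow> complex" where
  "braket V \<phi> \<psi> = (\<Sum>x\<in>Pow V. cnj (\<phi> x) * \<psi> x)"

definition ket_norm :: "'a set \<Rightarrow> 'a ket \<Rightarrow> real" where
  "ket_norm V \<psi> = sqrt (\<Sum>x\<in>Pow V. (cmod (\<psi> x))\<^sup>2)"

definition plus_state :: "'a set \<Rightarrow> 'a ket" where
  "plus_state V = (\<lambda>x. if x \<subseteq> V then 1 / complex_of_real (sqrt (2 ^ card V)) else 0)"

definition pauli_X :: "'a \<Rightarrow> 'a oper" where
  "pauli_X v \<psi> = (\<lambda>x. \<psi> (if v \<in> x then x - {v} else insert v x))"

definition pauli_Z :: "'a \<Rightarrow> 'a oper" where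
  "pauli_Z v \<psi> = (\<lambda>x. if v \<in> x then - \<psi> x else \<psi> x)"

definition op_scale :: "complex \<Rightarrow> 'a oper \<Rightarrow> 'a oper" where
  "op_scale c A \<psi> = (\<lambda>x. c * A \<psi> x)"

definition op_sum :: "('i \<Rightarrow> 'a oper) \<Rightarrow> 'i set \<Rightarrow> 'a oper" where
  "op_sum A S \<psi> = (\<lambda>x. \<Sum>i\<in>S. A i \<psi> x)"

text \<open>The product of a finite family of operators, used only for commuting families.\<close>

definition op_prod :: "('i \<Rightarrow> 'a oper) \<Rightarrow> 'i set \<Rightarrow> 'a oper" where
  "op_prod A S = Finite_Set.fold (\<lambda>i B. A i \<circ> B) id S"

definition op_exp :: "'a oper \<Rightarrow> 'a oper" where
  "op_exp A \<psi> = (\<lambda>x. \<Sum>k. (A ^^ k) \<psi> x / fact k)"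

text \<open>For an edge \<open>e\<close> with endpoints \<open>a\<close> and \<open>b\<close> this is \<open>Z\<^sub>a Z\<^sub>b\<close>.\<close>

abbreviation edge_ZZ :: "'a set \<Rightarrow> 'a oper" where
  "edge_ZZ e \<equiv> op_prod pauli_Z e"

definition maxcut :: "'a set set \<Rightarrow> 'a oper" where
  "maxcut E = op_sum (\<lambda>e \<psi> x. (\<psi> x - edge_ZZ e \<psi> x) / 2) E"

definition qaoa1 :: "'a set \<Rightarrow> 'a set set \<Rightarrow> real \<Rightarrow> real \<Rightarrow> 'a ket" where
  "qaoa1 V E \<beta> \<gamma> =
     op_exp (op_scale (- (\<i> * complex_of_real \<beta> / 2)) (op_sum pauli_X V))
       (op_exp (op_scale (- (\<i> * complex_of_real \<gamma> / 2)) (op_sum edge_ZZ E)) (plus_state V))"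

definition expval :: "'a set \<Rightarrow> 'a ket \<Rightarrow> 'a oper \<Rightarrow> complex" where
  "expval V \<psi> A = braket V \<psi> (A \<psi>)"

definition meas_proj :: "'a set \<Rightarrow> ('a \<Rightarrow> real) \<Rightarrow> 'a oper" where
  "meas_proj V0 \<sigma> =
     op_prod (\<lambda>v \<psi> x. (\<psi> x + complex_of_real (\<sigma> v) * pauli_Z v \<psi> x) / 2) V0"


section \<open>Polynomial-time computability\<close>

text \<open>The machine model is a random access machine, programmed with while loops and with unit cost
  per instruction, over a memory of natural numbers (addition, truncated subtraction, indirect
  addressing) and a memory of real numbers. The input is a table of natural numbers and a list of
  real parameters. Two restrictions keep unit cost honest: natural numbers cannot be multiplied, and
  a real number can be multiplied only by a rational constant of the program or by an input
  parameter. Thus after \<open>t\<close> instructions the natural numbers have \<open>O(t)\<close> more bits than the input,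
  and the real numbers are polynomials in the parameters of degree at most \<open>t\<close> with rational
  coefficients of \<open>O(t)\<close> bits. Control flow never depends on a real number.\<close>

datatype instr =
    NConst nat nat
  | NAdd nat nat nat
  | NSub nat nat nat
  | NLoad nat nat
  | NStore nat nat
  | NRead nat nat nat
  | RConst nat rat
  | RAdd nat nat nat
  | RScale nat rat
  | RMul nat nat

datatype com =
    Instr instr
  | Seq com com
  | Cond nat com com
  | While nat com

type_synonym memory = "(nat \<Rightarrow> nat) \<times> (nat \<Rightarrow> real)"

definition table_entry :: "nat list list \<Rightarrow> nat \<Rightarrow> nat \<Rightarrow> nat" where
  "table_entry T a b = (if a < length T \<and> b < length (T ! a) then T ! a ! b else 0)"

fun step :: "nat list list \<Rightarrow> real list \<Rightarrow> instr \<Rightarrow> memory \<Rightarrow> memory" where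
  "step T ps (NConst i k) (m, r) = (m(i := k), r)"
| "step T ps (NAdd i j k) (m, r) = (m(i := m j + m k), r)"
| "step T ps (NSub i j k) (m, r) = (m(i := m j - m k), r)"
| "step T ps (NLoad i j) (m, r) = (m(i := m (m j)), r)"
| "step T ps (NStore i j) (m, r) = (m(m i := m j), r)"
| "step T ps (NRead i j k) (m, r) = (m(i := table_entry T (m j) (m k)), r)"
| "step T ps (RConst i q) (m, r) = (m, r(i := of_rat q))"
| "step T ps (RAdd i j k) (m, r) = (m, r(i := r j + r k))"
| "step T ps (RScale i q) (m, r) = (m, r(i := of_rat q * r i))"
| "step T ps (RMul i l) (m, r) = (m, r(i := r i * (if l < length ps then ps ! l else 0)))"

text \<open>\<open>exec T ps c s t s'\<close>: on input \<open>T\<close>, \<open>ps\<close>, program \<open>c\<close> started in memory \<open>s\<close> terminates in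
  memory \<open>s'\<close> after \<open>t\<close> steps, every test of a condition counting as a step.\<close>

inductive exec :: "nat list list \<Rightarrow> real list \<Rightarrow> com \<Rightarrow> memory \<Rightarrow> nat \<Rightarrow> memory \<Rightarrow> bool"
  for T :: "nat list list" and ps :: "real list" where
  exec_Instr: "exec T ps (Instr a) s 1 (step T ps a s)"
| exec_Seq: "exec T ps c s t s' \<Longrightarrow> exec T ps d s' t' s'' \<Longrightarrow> exec T ps (Seq c d) s (t + t') s''"
| exec_Cond_True: "fst s i \<noteq> 0 \<Longrightarrow> exec T ps c s t s' \<Longrightarrow> exec T ps (Cond i c d) s (t + 1) s'"
| exec_Cond_False: "fst s i = 0 \<Longrightarrow> exec T ps d s t s' \<Longrightarrow> exec T ps (Cond i c d) s (t + 1) s'"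
| exec_While_True: "fst s i \<noteq> 0 \<Longrightarrow> exec T ps c s t s' \<Longrightarrow> exec T ps (While i c) s' t' s'' \<Longrightarrow>
    exec T ps (While i c) s (t + t' + 1) s''"
| exec_While_False: "fst s i = 0 \<Longrightarrow> exec T ps (While i c) s 1 s"

definition init_memory :: memory where
  "init_memory = ((\<lambda>_. 0), (\<lambda>_. 0))"

text \<open>The vertices are numbered by a list \<open>vs\<close>. The table consists of a header (number of vertices and
  the two vertices whose coupling is wanted), the indicator vector of \<open>V0\<close>, and the adjacency
  matrix.\<close>

definition encode :: "'a list \<Rightarrow> 'a set set \<Rightarrow> 'a set \<Rightarrow> nat \<Rightarrow> nat \<Rightarrow> nat list list" where
  "encode vs E V0 i j =
     [length vs, i, j]
     # map (\<lambda>v. of_bool (v \<in> V0)) vs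
     # map (\<lambda>v. map (\<lambda>w. of_bool ({v, w} \<in> E)) vs) vs"

text \<open>One program has to work, within one polynomial time bound, for all instances, all numberings of
  the vertices and all angles. The angles are given to it through their cosines and sines. The
  result is left in the first cell of the real memory.\<close>

definition efficiently_computable ::
    "('a set \<Rightarrow> 'a set set \<Rightarrow> 'a set \<Rightarrow> real \<Rightarrow> real \<Rightarrow> 'a set \<Rightarrow> real) \<Rightarrow> bool" where
  "efficiently_computable J \<longleftrightarrow>
     (\<exists>(c :: com) (p :: nat poly). \<forall>V E V0 \<beta> \<gamma> vs i j.
        cubic_graph V E \<and> two_independent V E V0 \<and> distinct vs \<and> set vs = V \<and>
        i < length vs \<and> j < length vs \<and> i \<noteq> j \<and> vs ! i \<in> V0 \<and> vs ! j \<in> V0 \<longrightarrow>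
        (\<exists>t s. exec (encode vs E V0 i j) [cos \<beta>, sin \<beta>, cos \<gamma>, sin \<gamma>] c init_memory t s \<and>
               t \<le> poly p (card V) \<and>
               snd s 0 = J V E V0 \<beta> \<gamma> {vs ! i, vs ! j}))"

end

theory Submission
  imports Defs
begin

text \<open>Let \<open>\<langle>Z\<^sub>S\<rangle>\<close> be the expectation of \<open>\<Prod>v\<in>S. Z\<^sub>v\<close> in the QAOA state. Passing to the Heisenberg picture,
  \<open>\<langle>Z\<^sub>S\<rangle>\<close> becomes a sum over \<open>R \<subseteq> S\<close> (the qubits on which the mixer flips) of averages over basis
  states \<open>x\<close> of \<open>\<Prod>v\<in>S. z\<^sub>v(x)\<close> times the phases of the edges leaving \<open>R\<close>. Expanding the phases, a
  term survives only if some set \<open>F\<close> of edges leaving \<open>R\<close> has odd degree exactly at the vertices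
  of \<open>S\<close>. For \<open>S = T\<close> or \<open>S = e \<triangle> T\<close> with \<open>T \<subseteq> V\<^sub>0\<close> and an edge \<open>e\<close>, 2-independence turns each
  \<open>t \<in> T - e\<close> injectively into an edge of \<open>F\<close> that leaves \<open>e\<close> within distance 1 of \<open>t\<close>, and
  3-regularity with the parity conditions leaves room for at most two of them. Hence
  \<open>\<langle>Z\<^sub>T\<rangle> = 0\<close> for \<open>T \<noteq> {}\<close>, the outcome distribution on \<open>V\<^sub>0\<close> is uniform, and expanding the
  projector leaves only \<open>T = {}\<close> and pairs \<open>T\<close> close to \<open>e\<close>.

  For the algorithm, averaging first over the qubits outside \<open>R\<close> turns \<open>\<langle>Z\<^sub>S\<rangle>\<close> into a sum of
  \<open>3\<^bsup>|S|\<^esup>\<close> terms, one for each labelling \<open>S \<rightarrow> {0, 1, -1}\<close>, each a product over all vertices \<open>u\<close> of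
  \<open>cos\<close> or \<open>sin\<close> of \<open>\<gamma>\<close> times the sum of the labels at the neighbours of \<open>u\<close>; only sets with
  at most four elements occur.\<close>

section \<open>Characters and the mixer\<close>

text \<open>Eigenvalue of \<open>pauli_Z v\<close> on the basis state \<open>x\<close>; complex so
  that it multiplies amplitudes without coercions.\<close>

definition spin :: "'a \<Rightarrow> 'a set \<Rightarrow> complex" where
  "spin v x = (if v \<in> x then -1 else 1)"

text \<open>Eigenvalue of the Z string on \<open>S\<close>. As functions of \<open>x\<close> these
  are the characters of the group of vertex sets under symmetric difference, so they diagonalise all
  bit flips.\<close>

definition chi :: "'a set \<Rightarrow> 'a set \<Rightarrow> complex" where
  "chi S x = (\<Prod>v\<in>S. spin v x)"

lemma spin_sym_diff: "spin v (sym_diff x y) = spin v x * spin v y"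
  by (auto simp: spin_def)

lemma spin_mult_self [simp]: "spin v x * spin v x = 1"
  by (simp add: spin_def)

lemma cnj_spin [simp]: "cnj (spin v x) = spin v x"
  by (simp add: spin_def)

lemma cnj_chi [simp]: "cnj (chi S x) = chi S x"
  by (simp add: chi_def)

lemma chi_empty [simp]: "chi {} x = 1"
  by (simp add: chi_def)

lemma chi_sym_diff_right: "chi S (sym_diff x y) = chi S x * chi S y"
  by (simp add: chi_def spin_sym_diff prod.distrib)

lemma chi_eq_power: "finite S \<Longrightarrow> chi S x = (-1) ^ card (S \<inter> x)"
  by (induction S rule: finite_induct) (auto simp: chi_def spin_def Int_insert_left)

lemma chi_commute: "finite S \<Longrightarrow> finite x \<Longrightarrow> chi S x = chi x S"
  by (simp add: chi_eq_power Int_commute)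

lemma chi_mult_self [simp]: "chi S x * chi S x = 1"
  by (simp add: chi_def flip: prod.distrib)

lemma chi_sym_diff_left:
  assumes "finite A" "finite B"
  shows "chi (sym_diff A B) x = chi A x * chi B x"
proof -
  have *: "chi (sym_diff A B) x = chi (A - B) x * chi (B - A) x"
    unfolding chi_def using assms by (intro prod.union_disjoint) auto
  have A: "chi A x = chi (A - B) x * chi (A \<inter> B) x"
    unfolding chi_def using assms by (subst prod.union_disjoint [symmetric]) (auto intro!: prod.cong)
  have B: "chi B x = chi (B - A) x * chi (A \<inter> B) x"
    unfolding chi_def using assms by (subst prod.union_disjoint [symmetric]) (auto intro!: prod.cong)
  have "chi A x * chi B x = chi (A - B) x * chi (B - A) x * (chi (A \<inter> B) x * chi (A \<inter> B) x)"
    unfolding A B by (simp only: mult_ac)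
  then show ?thesis by (simp add: *)
qed

text \<open>Toggling \<open>v\<close> permutes the basis states and negates the summand, so the sum
  equals its own negative.\<close>

lemma sum_Pow_flip:
  fixes f :: "'a set \<Rightarrow> complex"
  assumes "v \<in> V" "\<And>x. x \<subseteq> V \<Longrightarrow> f (sym_diff x {v}) = - f x"
  shows "(\<Sum>x\<in>Pow V. f x) = 0"
proof -
  have "(\<Sum>x\<in>Pow V. f x) = (\<Sum>x\<in>Pow V. f (sym_diff x {v}))"
    using assms(1)
    by (intro sum.reindex_bij_witness[of _ "\<lambda>x. sym_diff x {v}" "\<lambda>x. sym_diff x {v}"])
       (auto intro!: arg_cong[of _ _ f])
  also have "\<dots> = - (\<Sum>x\<in>Pow V. f x)"
    using assms(2) by (simp add: sum_negf)
  finally show ?thesis by simp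
qed

lemma sum_chi:
  assumes "finite V" "S \<subseteq> V"
  shows "(\<Sum>x\<in>Pow V. chi S x) = (if S = {} then 2 ^ card V else 0)"
proof (cases "S = {}")
  case True
  then show ?thesis using assms by (simp add: card_Pow)
next
  case False
  then obtain v where v: "v \<in> S" by blast
  have "finite S" using assms finite_subset by blast
  then have "chi S {v} = -1" using v by (simp add: chi_eq_power)
  then have "(\<Sum>x\<in>Pow V. chi S x) = 0"
    using v assms by (intro sum_Pow_flip[of v]) (auto simp only: chi_sym_diff_right mult_minus1_right)
  then show ?thesis using False by simp
qed

text \<open>Fourier inversion. Only the existence of coefficients is exported, because later
  arguments are linear or bilinear in them.\<close>

lemma fourier_expansion:
  assumes "finite V"
  obtains a where "\<And>x. x \<in> Pow V \<Longrightarrow> f x = (\<Sum>y\<in>Pow V. a y * chi y x)"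
proof
  fix x assume x: "x \<in> Pow V"
  have fin: "finite y" if "y \<subseteq> V" for y using assms that finite_subset by blast
  have "(\<Sum>y\<in>Pow V. (\<Sum>z\<in>Pow V. f z * chi y z) / 2 ^ card V * chi y x)
      = (\<Sum>z\<in>Pow V. \<Sum>y\<in>Pow V. f z * chi y (sym_diff z x) / 2 ^ card V)"
    unfolding chi_sym_diff_right
    by (subst sum.swap) (simp add: sum_distrib_right sum_divide_distrib mult.assoc)
  also have "\<dots> = (\<Sum>z\<in>Pow V. if z = x then f z else 0)"
  proof (intro sum.cong refl)
    fix z assume z: "z \<in> Pow V"
    \<comment> \<open>Exchanging index and argument turns a sum over characters into a sum of one
      character, to which orthogonality applies.\<close>
    have "(\<Sum>y\<in>Pow V. chi y (sym_diff z x)) = (\<Sum>y\<in>Pow V. chi (sym_diff z x) y)"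
      using x z by (intro sum.cong refl chi_commute) (auto intro: fin)
    also have "\<dots> = (if z = x then 2 ^ card V else 0)"
      using x z assms by (subst sum_chi) auto
    finally show "(\<Sum>y\<in>Pow V. f z * chi y (sym_diff z x) / 2 ^ card V) = (if z = x then f z else 0)"
      by (simp flip: sum_divide_distrib sum_distrib_left)
  qed
  finally show "f x = (\<Sum>y\<in>Pow V. (\<Sum>z\<in>Pow V. f z * chi y z) / 2 ^ card V * chi y x)"
    using x assms by simp
qed

section \<open>The mixer in the character basis\<close>

definition mixer :: "'a set \<Rightarrow> complex \<Rightarrow> 'a oper" where
  "mixer V c = op_exp (op_scale c (op_sum pauli_X V))"

lemma pauli_X_eq: "pauli_X v \<psi> x = \<psi> (sym_diff x {v})"
  by (auto simp: pauli_X_def intro!: arg_cong[of _ _ \<psi>])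

text \<open>Flipping \<open>v\<close> multiplies \<open>chi y\<close> by \<open>spin v y\<close>, so
  \<open>chi y\<close> is an eigenvector of the sum of all X operators. The exponential series can
  then be summed separately for each of the finitely many characters.\<close>

lemma mixer_fourier:
  assumes V: "finite V" and f: "\<And>x. x \<in> Pow V \<Longrightarrow> f x = (\<Sum>y\<in>Pow V. a y * chi y x)"
    and x: "x \<in> Pow V"
  shows "mixer V c f x = (\<Sum>y\<in>Pow V. a y * exp (c * (\<Sum>v\<in>V. spin v y)) * chi y x)"
proof -
  define A where "A = op_scale c (op_sum pauli_X V)"
  define l where "l y = c * (\<Sum>v\<in>V. spin v y)" for y
  have pow: "(A ^^ k) f x = (\<Sum>y\<in>Pow V. a y * l y ^ k * chi y x)" if "x \<in> Pow V" for k x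
    using that
  proof (induction k arbitrary: x)
    case 0
    then show ?case by (simp add: f)
  next
    case (Suc k)
    have "(A ^^ Suc k) f x = c * (\<Sum>v\<in>V. (A ^^ k) f (sym_diff x {v}))"
      by (simp add: A_def op_scale_def op_sum_def pauli_X_eq)
    also have "\<dots> = c * (\<Sum>v\<in>V. \<Sum>y\<in>Pow V. a y * l y ^ k * (chi y x * spin v y))"
    proof -
      have "(A ^^ k) f (sym_diff x {v}) = (\<Sum>y\<in>Pow V. a y * l y ^ k * (chi y x * spin v y))"
        if v: "v \<in> V" for v
      proof -
        have "sym_diff x {v} \<in> Pow V" using v Suc.prems by auto
        then have "(A ^^ k) f (sym_diff x {v}) = (\<Sum>y\<in>Pow V. a y * l y ^ k * chi y (sym_diff x {v}))"
          by (rule Suc.IH)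
        moreover have "chi y {v} = spin v y" if "y \<in> Pow V" for y
          using that V finite_subset[of y V] by (auto simp: chi_eq_power spin_def)
        ultimately show ?thesis unfolding chi_sym_diff_right by simp
      qed
      then show ?thesis by simp
    qed
    also have "\<dots> = (\<Sum>y\<in>Pow V. a y * l y ^ Suc k * chi y x)"
      by (subst sum.swap) (simp add: l_def sum_distrib_left sum_distrib_right mult_ac)
    finally show ?case .
  qed
  have "mixer V c f x = (\<Sum>k. \<Sum>y\<in>Pow V. a y * chi y x * (l y ^ k / fact k))"
    unfolding mixer_def op_exp_def A_def [symmetric]
    using x by (simp add: pow sum_divide_distrib mult_ac)
  also have "\<dots> = (\<Sum>y\<in>Pow V. a y * chi y x * exp (l y))"
  proof -
    have "(\<lambda>k. l y ^ k / fact k) sums exp (l y)" for y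
      using exp_converges[of "l y"] by (simp add: scaleR_conv_of_real divide_inverse mult.commute)
    then have "(\<lambda>k. \<Sum>y\<in>Pow V. a y * chi y x * (l y ^ k / fact k)) sums (\<Sum>y\<in>Pow V. a y * chi y x * exp (l y))"
      by (intro sums_sum sums_mult)
    then show ?thesis by (simp add: sums_iff)
  qed
  finally show ?thesis by (simp add: l_def mult_ac)
qed

text \<open>Euler's formula: \<open>spin\<close> is a sign, cosine is even and sine is odd.\<close>

lemma exp_i_spin: "exp (\<i> * of_real \<theta> * spin v x) = of_real (cos \<theta>) + \<i> * of_real (sin \<theta>) * spin v x"
proof -
  have "exp (\<i> * of_real \<theta>) = of_real (cos \<theta>) + \<i> * of_real (sin \<theta>)" "exp (- (\<i> * of_real \<theta>)) = of_real (cos \<theta>) - \<i> * of_real (sin \<theta>)"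
    using exp_Euler[of "of_real \<theta>"] exp_Euler[of "- of_real \<theta>"] by (simp_all add: cos_of_real sin_of_real)
  then show ?thesis by (simp add: spin_def)
qed

text \<open>The Heisenberg picture: conjugation by the mixer maps \<open>Z\<^sub>v\<close> to
  \<open>cos \<beta> Z\<^sub>v - i sin \<beta> Z\<^sub>v X\<^sub>v\<close>. By bilinearity it suffices to compare
  matrix elements between characters, which are eigenvectors of the mixer.\<close>

lemma mixer_conj:
  assumes V: "finite V" and S: "S \<subseteq> V"
  shows "(\<Sum>x\<in>Pow V. chi S x * (cnj (mixer V (- (\<i> * of_real \<beta> / 2)) f x) * mixer V (- (\<i> * of_real \<beta> / 2)) f x))
    = (\<Sum>R\<in>Pow S. of_real (cos \<beta>) ^ card (S - R) * (- \<i> * of_real (sin \<beta>)) ^ card R *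
        (\<Sum>x\<in>Pow V. chi S x * (cnj (f x) * f (sym_diff x R))))"
proof -
  have fin: "finite y" if "y \<subseteq> V" for y using V that finite_subset by blast
  define c where "c = - (\<i> * of_real \<beta> / 2)"
  define l where "l y = (\<Sum>v\<in>V. spin v y)" for y
  define w where "w R = of_real (cos \<beta>) ^ card (S - R) * (- \<i> * of_real (sin \<beta>)) ^ card R" for R
  obtain a where a: "\<And>x. x \<in> Pow V \<Longrightarrow> f x = (\<Sum>y\<in>Pow V. a y * chi y x)"
    using fourier_expansion[OF V] by blast
  have l_cnj: "cnj (exp (c * l y)) = exp (- c * l y)" for y
    by (simp add: c_def l_def exp_cnj)
  \<comment> \<open>Matrix element of the Z string on \<open>S\<close> between two characters; by
    orthogonality it vanishes unless \<open>y\<close> is the symmetric difference of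
    \<open>z\<close> and \<open>S\<close>.\<close>
  define k where "k y z = (\<Sum>x\<in>Pow V. chi S x * (chi y x * chi z x))" for y z
  have main: "exp (- c * l y) * exp (c * l z) * k y z = (\<Sum>R\<in>Pow S. w R * chi z R) * k y z"
    if y: "y \<in> Pow V" and z: "z \<in> Pow V" for y z
  proof (cases "y = sym_diff z S")
    case True
    \<comment> \<open>The eigenvalues for \<open>z\<close> and \<open>y\<close> differ only at
      vertices of \<open>S\<close>, where the sign is reversed; the doubling turns the half angle
      into \<open>\<beta>\<close>.\<close>
    have "c * l z - c * l y = c * (\<Sum>v\<in>V. spin v z * (1 - spin v S))"
      unfolding l_def True spin_sym_diff by (simp add: sum_subtractf right_diff_distrib)
    also have "(\<Sum>v\<in>V. spin v z * (1 - spin v S)) = (\<Sum>v\<in>S. 2 * spin v z)"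
      using V S by (intro sum.mono_neutral_cong_right) (auto simp: spin_def)
    also have "c * \<dots> = (\<Sum>v\<in>S. \<i> * of_real (-\<beta>) * spin v z)"
      by (simp add: c_def sum_distrib_left mult_ac)
    finally have "exp (- c * l y) * exp (c * l z) = exp (\<Sum>v\<in>S. \<i> * of_real (-\<beta>) * spin v z)"
      by (simp flip: exp_add)
    also have "\<dots> = (\<Prod>v\<in>S. (- \<i> * of_real (sin \<beta>) * spin v z) + of_real (cos \<beta>))"
      using fin[OF S] unfolding exp_sum [OF fin [OF S]] exp_i_spin by (simp add: algebra_simps)
    also have "\<dots> = (\<Sum>R\<in>Pow S. w R * chi R z)"
      unfolding prod_add[OF fin[OF S]]
      by (simp only: w_def chi_def prod.distrib prod_constant power_mult_distrib mult_ac)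
    \<comment> \<open>In this form the character value is the factor that \<open>chi z\<close>
      acquires when its argument is shifted by \<open>R\<close>, i.e. when the qubits in
      \<open>R\<close> are flipped.\<close>
    also have "\<dots> = (\<Sum>R\<in>Pow S. w R * chi z R)"
    proof (intro sum.cong refl)
      fix R assume "R \<in> Pow S"
      then have "chi R z = chi z R" using z S by (intro chi_commute fin) auto
      then show "w R * chi R z = w R * chi z R" by simp
    qed
    finally show ?thesis by simp
  next
    case False
    have "k y z = (\<Sum>x\<in>Pow V. chi (sym_diff S (sym_diff y z)) x)"
      unfolding k_def using y z S
      by (simp add: fin chi_sym_diff_left)
    also have "\<dots> = 0" using y z S V False by (subst sum_chi) auto
    finally show ?thesis by simp
  qed
  have U: "mixer V c f x = (\<Sum>z\<in>Pow V. a z * exp (c * l z) * chi z x)" if "x \<in> Pow V" for x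
    unfolding l_def by (rule mixer_fourier[OF V a that])
  have "(\<Sum>x\<in>Pow V. chi S x * (cnj (mixer V c f x) * mixer V c f x))
     = (\<Sum>x\<in>Pow V. chi S x * ((\<Sum>y\<in>Pow V. cnj (a y) * exp (- c * l y) * chi y x) * (\<Sum>z\<in>Pow V. a z * exp (c * l z) * chi z x)))"
    by (intro sum.cong refl arg_cong2[of _ _ _ _ "(*)"]) (simp_all only: U cnj_sum complex_cnj_mult l_cnj cnj_chi)
  also have "\<dots> = (\<Sum>y\<in>Pow V. \<Sum>z\<in>Pow V. cnj (a y) * a z * (exp (- c * l y) * exp (c * l z) * k y z))"
    unfolding k_def sum_product sum_distrib_left sum_distrib_right
    by (rule trans[OF sum.cong[OF refl sum.swap]], rule trans[OF sum.swap], rule sum.cong[OF refl],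
        rule trans[OF sum.swap]) (simp add: mult_ac)
  also have "\<dots> = (\<Sum>y\<in>Pow V. \<Sum>z\<in>Pow V. cnj (a y) * a z * ((\<Sum>R\<in>Pow S. w R * chi z R) * k y z))"
    by (simp only: main cong: sum.cong)
  also have "\<dots> = (\<Sum>R\<in>Pow S. w R * (\<Sum>x\<in>Pow V. \<Sum>y\<in>Pow V. \<Sum>z\<in>Pow V. chi S x * ((cnj (a y) * chi y x) * (a z * (chi z x * chi z R)))))"
  proof -
    have "(\<Sum>y\<in>Pow V. \<Sum>z\<in>Pow V. cnj (a y) * a z * ((\<Sum>R\<in>Pow S. w R * chi z R) * k y z))
      = (\<Sum>y\<in>Pow V. \<Sum>z\<in>Pow V. \<Sum>R\<in>Pow S. \<Sum>x\<in>Pow V. w R * (chi S x * ((cnj (a y) * chi y x) * (a z * (chi z x * chi z R)))))"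
      unfolding k_def sum_product by (simp only: sum_distrib_left mult_ac)
    also have "\<dots> = (\<Sum>R\<in>Pow S. \<Sum>x\<in>Pow V. \<Sum>y\<in>Pow V. \<Sum>z\<in>Pow V. w R * (chi S x * ((cnj (a y) * chi y x) * (a z * (chi z x * chi z R)))))"
      by (rule trans[OF sum.cong[OF refl sum.swap]], rule trans[OF sum.swap], rule sum.cong[OF refl],
          rule trans[OF sum.cong[OF refl sum.swap]], rule sum.swap)
    finally show ?thesis by (simp add: sum_distrib_left)
  qed
  also have "\<dots> = (\<Sum>R\<in>Pow S. w R * (\<Sum>x\<in>Pow V. chi S x * (cnj (f x) * f (sym_diff x R))))"
  proof (intro sum.cong refl arg_cong2[of _ _ _ _ "(*)"])
    fix R x assume R: "R \<in> Pow S" and x: "x \<in> Pow V"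
    have "sym_diff x R \<in> Pow V" using R x S by auto
    then show "(\<Sum>y\<in>Pow V. \<Sum>z\<in>Pow V. chi S x * ((cnj (a y) * chi y x) * (a z * (chi z x * chi z R))))
      = chi S x * (cnj (f x) * f (sym_diff x R))"
      by (simp only: a[OF x] a[of "sym_diff x R"] chi_sym_diff_right cnj_sum complex_cnj_mult cnj_chi sum_product)
         (simp only: sum_distrib_left)
  qed
  finally show ?thesis by (simp add: w_def c_def)
qed

section \<open>Correlators\<close>

text \<open>\<open>op_prod\<close> is a fold, which unfolds only for commuting operators; diagonal
  operators commute.\<close>

lemma op_prod_diagonal:
  assumes "finite S" and A: "\<And>i \<psi>. A i \<psi> = (\<lambda>x. d i x * \<psi> x)"
  shows "op_prod A S \<psi> = (\<lambda>x. (\<Prod>i\<in>S. d i x) * \<psi> x)"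
proof -
  interpret comp_fun_commute "\<lambda>i B. A i \<circ> B"
    by standard (auto simp: fun_eq_iff A)
  show ?thesis
    using assms(1)
  proof (induction S rule: finite_induct)
    case empty
    then show ?case by (simp add: op_prod_def)
  next
    case (insert i S)
    have "op_prod A (insert i S) = A i \<circ> op_prod A S"
      unfolding op_prod_def using insert.hyps by (rule fold_insert)
    then have "op_prod A (insert i S) \<psi> = A i (op_prod A S \<psi>)"
      by (metis comp_apply)
    also have "\<dots> = (\<lambda>x. (\<Prod>i\<in>insert i S. d i x) * \<psi> x)"
      unfolding insert.IH unfolding A using insert.hyps by (simp add: mult.assoc)
    finally show ?case .
  qed
qed

lemma op_exp_diagonal:
  assumes A: "\<And>\<psi>. A \<psi> = (\<lambda>x. d x * \<psi> x)"
  shows "op_exp A \<psi> x = exp (d x) * \<psi> x"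
proof -
  have "(A ^^ k) \<psi> x = d x ^ k * \<psi> x" for k
    by (induction k) (simp_all add: A)
  moreover have "(\<lambda>k. d x ^ k * \<psi> x / fact k) sums (exp (d x) * \<psi> x)"
    using sums_mult2[OF exp_converges[of "d x"], of "\<psi> x"]
    by (simp add: scaleR_conv_of_real divide_inverse mult_ac)
  ultimately show ?thesis by (simp add: op_exp_def sums_iff)
qed

lemma pauli_Z_diagonal: "pauli_Z v \<psi> = (\<lambda>x. spin v x * \<psi> x)"
  by (auto simp: pauli_Z_def spin_def)

lemma op_prod_pauli_Z: "finite S \<Longrightarrow> op_prod pauli_Z S \<psi> = (\<lambda>x. chi S x * \<psi> x)"
  unfolding chi_def by (rule op_prod_diagonal[OF _ pauli_Z_diagonal])

text \<open>The edges cut by \<open>R\<close>: exactly those whose ZZ eigenvalue changes sign when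
  the qubits in \<open>R\<close> are flipped.\<close>

definition boundary :: "'a set set \<Rightarrow> 'a set \<Rightarrow> 'a set set" where
  "boundary E R = {e \<in> E. card (e \<inter> R) = 1}"

text \<open>Expectation of the Z string on \<open>S\<close> in the QAOA state, written through the
  outcome probabilities because the string is diagonal.\<close>

definition corr :: "'a set \<Rightarrow> 'a set set \<Rightarrow> real \<Rightarrow> real \<Rightarrow> 'a set \<Rightarrow> complex" where
  "corr V E \<beta> \<gamma> S = (\<Sum>x\<in>Pow V. chi S x * (cnj (qaoa1 V E \<beta> \<gamma> x) * qaoa1 V E \<beta> \<gamma> x))"

lemma cubic_graphD:
  assumes "cubic_graph V E"
  shows "finite V" "finite E" "\<And>e. e \<in> E \<Longrightarrow> e \<subseteq> V" "\<And>e. e \<in> E \<Longrightarrow> card e = 2"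
    "\<And>e. e \<in> E \<Longrightarrow> finite e" "\<And>v. v \<in> V \<Longrightarrow> card {e \<in> E. v \<in> e} = 3"
proof -
  show "finite V" and V: "\<And>e. e \<in> E \<Longrightarrow> e \<subseteq> V" and e: "\<And>e. e \<in> E \<Longrightarrow> card e = 2"
    and "\<And>v. v \<in> V \<Longrightarrow> card {e \<in> E. v \<in> e} = 3"
    using assms by (auto simp: cubic_graph_def)
  show "finite e" if "e \<in> E" for e using e[OF that] card.infinite by fastforce
  have "E \<subseteq> Pow V" using V by auto
  then show "finite E" using \<open>finite V\<close> finite_subset by auto
qed

lemma chi_cases: "chi S x = 1 \<or> chi S x = -1"
  using chi_mult_self[of S x] square_eq_1_iff by blast

text \<open>\<open>chi\<close> also takes only the values 1 and -1, which \<open>spin\<close>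
  attains at \<open>{}\<close> and \<open>UNIV\<close>; this reduces the claim to Euler's formula
  for \<open>spin\<close>.\<close>

lemma exp_i_chi: "exp (\<i> * of_real \<theta> * chi S x) = of_real (cos \<theta>) + \<i> * of_real (sin \<theta>) * chi S x"
  using chi_cases[of S x] exp_i_spin[of \<theta> undefined "{}"] exp_i_spin[of \<theta> undefined UNIV]
  by (auto simp: spin_def)

text \<open>The Heisenberg formula for the mixer is applied to the state after the phase layer.
  Between \<open>x\<close> and its flip by \<open>R\<close>, the phases of edges with zero or two
  ends in \<open>R\<close> cancel, while those of cut edges double from \<open>\<gamma> / 2\<close>
  to \<open>\<gamma>\<close>.\<close>

lemma corr_eq:
  assumes G: "cubic_graph V E" and S: "S \<subseteq> V"
  shows "corr V E \<beta> \<gamma> S =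
    (\<Sum>R\<in>Pow S. of_real (cos \<beta>) ^ card (S - R) * (- \<i> * of_real (sin \<beta>)) ^ card R *
      ((\<Sum>x\<in>Pow V. chi S x * exp (\<i> * of_real \<gamma> * (\<Sum>e\<in>boundary E R. chi e x))) / 2 ^ card V))"
proof -
  note G' = cubic_graphD[OF G]
  define c where "c = - (\<i> * of_real \<gamma> / 2)"
  define \<phi> where "\<phi> = op_exp (op_scale c (op_sum edge_ZZ E)) (plus_state V)"
  have "op_scale c (op_sum edge_ZZ E) \<psi> = (\<lambda>x. c * (\<Sum>e\<in>E. chi e x) * \<psi> x)" for \<psi>
    using G'(5) by (auto simp: op_scale_def op_sum_def op_prod_pauli_Z mult.assoc sum_distrib_right
        intro!: sum.cong)
  from op_exp_diagonal[OF this]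
  have \<phi>: "\<phi> x = exp (c * (\<Sum>e\<in>E. chi e x)) / of_real (sqrt (2 ^ card V))" if "x \<subseteq> V" for x
    using that by (simp add: \<phi>_def plus_state_def)
  have norm: "of_real (sqrt (2 ^ card V)) * complex_of_real (sqrt (2 ^ card V)) = 2 ^ card V"
    by (simp flip: of_real_mult)
  have overlap: "cnj (\<phi> x) * \<phi> (sym_diff x R) = exp (\<i> * of_real \<gamma> * (\<Sum>e\<in>boundary E R. chi e x)) / 2 ^ card V"
    if "x \<in> Pow V" "R \<in> Pow S" for x R
  proof -
    have V: "x \<subseteq> V" "sym_diff x R \<subseteq> V" using that S by auto
    have "cnj c = - c" by (simp add: c_def)
    then have "cnj (\<phi> x) = exp (- c * (\<Sum>e\<in>E. chi e x)) / of_real (sqrt (2 ^ card V))"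
      by (simp add: \<phi>[OF V(1)] exp_cnj)
    then have "cnj (\<phi> x) * \<phi> (sym_diff x R) =
        exp (- c * (\<Sum>e\<in>E. chi e x) + c * (\<Sum>e\<in>E. chi e (sym_diff x R))) / 2 ^ card V"
      by (simp only: \<phi>[OF V(2)] times_divide_times_eq norm exp_add)
    also have "- c * (\<Sum>e\<in>E. chi e x) + c * (\<Sum>e\<in>E. chi e (sym_diff x R)) = - c * (\<Sum>e\<in>E. chi e x * (1 - chi e R))"
      by (simp add: chi_sym_diff_right right_diff_distrib sum_subtractf)
    \<comment> \<open>\<open>chi e R\<close> is -1 exactly when one of the two ends of
      \<open>e\<close> lies in \<open>R\<close>.\<close>
    also have "(\<Sum>e\<in>E. chi e x * (1 - chi e R)) = (\<Sum>e\<in>boundary E R. 2 * chi e x)"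
    proof (intro sum.mono_neutral_cong_right ballI)
      have *: "card (e \<inter> R) \<le> 2" if "e \<in> E" for e
        using that G'(4,5) card_mono[of e "e \<inter> R"] by fastforce
      show "chi e x * (1 - chi e R) = 0" if "e \<in> E - boundary E R" for e
      proof -
        have "card (e \<inter> R) = 0 \<or> card (e \<inter> R) = 2" using that *[of e] by (auto simp: boundary_def)
        then show ?thesis using that G'(5) by (auto simp: chi_eq_power)
      qed
      show "chi e x * (1 - chi e R) = 2 * chi e x" if "e \<in> boundary E R" for e
        using that G'(5) by (auto simp: boundary_def chi_eq_power[of _ R])
    qed (auto simp: boundary_def G')
    also have "- c * (\<Sum>e\<in>boundary E R. 2 * chi e x) = \<i> * of_real \<gamma> * (\<Sum>e\<in>boundary E R. chi e x)"
      by (simp add: c_def sum_distrib_left[symmetric])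
    finally show ?thesis .
  qed
  have "qaoa1 V E \<beta> \<gamma> = mixer V (- (\<i> * of_real \<beta> / 2)) \<phi>"
    by (simp add: qaoa1_def mixer_def \<phi>_def c_def)
  then have "corr V E \<beta> \<gamma> S = (\<Sum>R\<in>Pow S. of_real (cos \<beta>) ^ card (S - R) * (- \<i> * of_real (sin \<beta>)) ^ card R *
      (\<Sum>x\<in>Pow V. chi S x * (cnj (\<phi> x) * \<phi> (sym_diff x R))))"
    using mixer_conj[OF G'(1) S] by (simp only: corr_def)
  also have "\<dots> = (\<Sum>R\<in>Pow S. of_real (cos \<beta>) ^ card (S - R) * (- \<i> * of_real (sin \<beta>)) ^ card R *
      (\<Sum>x\<in>Pow V. chi S x * (exp (\<i> * of_real \<gamma> * (\<Sum>e\<in>boundary E R. chi e x)) / 2 ^ card V)))"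
    by (simp only: overlap cong: sum.cong)
  finally show ?thesis by (simp only: times_divide_eq_right sum_divide_distrib)
qed

text \<open>Each phase splits into a cosine and a sine times a character. Choosing the sine for the
  edges in \<open>F\<close> yields a product of characters, whose sum over all states vanishes
  unless every vertex occurs an even number of times. What survives is a combinatorial certificate
  free of the angles.\<close>

lemma corr_nonzero:
  assumes G: "cubic_graph V E" and S: "S \<subseteq> V" and "corr V E \<beta> \<gamma> S \<noteq> 0"
  obtains R F where "R \<subseteq> S" "F \<subseteq> boundary E R" "\<And>u. u \<in> V \<Longrightarrow> odd (card {f \<in> F. u \<in> f}) \<longleftrightarrow> u \<in> S"
proof -
  note G' = cubic_graphD[OF G]
  have "\<exists>R\<in>Pow S. (\<Sum>x\<in>Pow V. chi S x * exp (\<i> * of_real \<gamma> * (\<Sum>e\<in>boundary E R. chi e x))) \<noteq> 0"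
  proof (rule ccontr)
    assume "\<not> ?thesis"
    then have "corr V E \<beta> \<gamma> S = 0" unfolding corr_eq[OF G S] by (intro sum.neutral) simp
    with assms(3) show False by simp
  qed
  then obtain R where R: "R \<subseteq> S"
    and nz: "(\<Sum>x\<in>Pow V. chi S x * exp (\<i> * of_real \<gamma> * (\<Sum>e\<in>boundary E R. chi e x))) \<noteq> 0"
    by auto
  have fin: "finite (boundary E R)" using G'(2) by (auto simp: boundary_def)
  define w where "w F = (\<i> * of_real (sin \<gamma>)) ^ card F * of_real (cos \<gamma>) ^ card (boundary E R - F)" for F :: "'a set set"
  have expand: "exp (\<i> * of_real \<gamma> * (\<Sum>e\<in>boundary E R. chi e x))
      = (\<Sum>F\<in>Pow (boundary E R). w F * (\<Prod>e\<in>F. chi e x))" for x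
  proof -
    have "exp (\<i> * of_real \<gamma> * (\<Sum>e\<in>boundary E R. chi e x))
      = (\<Prod>e\<in>boundary E R. \<i> * of_real (sin \<gamma>) * chi e x + of_real (cos \<gamma>))"
      by (simp only: sum_distrib_left exp_sum[OF fin] exp_i_chi add.commute)
    then show ?thesis unfolding prod_add[OF fin]
      by (simp only: w_def prod.distrib prod_constant power_mult_distrib mult_ac)
  qed
  have "(\<Sum>x\<in>Pow V. chi S x * exp (\<i> * of_real \<gamma> * (\<Sum>e\<in>boundary E R. chi e x)))
    = (\<Sum>F\<in>Pow (boundary E R). w F * (\<Sum>x\<in>Pow V. chi S x * (\<Prod>e\<in>F. chi e x)))"
    unfolding expand unfolding sum_distrib_left by (subst sum.swap) (simp only: mult_ac)
  with nz obtain F where F: "F \<subseteq> boundary E R" and nzF: "(\<Sum>x\<in>Pow V. chi S x * (\<Prod>e\<in>F. chi e x)) \<noteq> 0"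
    by (metis (no_types, lifting) Pow_iff mult_zero_right sum.neutral)
  have finF: "finite F" using F fin finite_subset by blast
  have finf: "finite f" if "f \<in> F" for f using F that G'(5) by (auto simp: boundary_def)
  have "odd (card {f \<in> F. u \<in> f}) \<longleftrightarrow> u \<in> S" if u: "u \<in> V" for u
  proof (rule ccontr)
    \<comment> \<open>A vertex of the wrong parity makes the summand odd under its flip, so the
      whole sum cancels.\<close>
    assume mismatch: "\<not> ?thesis"
    have "chi S {u} = (if u \<in> S then -1 else 1)"
      using S G'(1) finite_subset[of S V] by (auto simp: chi_eq_power)
    moreover have "(\<Prod>e\<in>F. chi e {u}) = (-1) ^ card {f \<in> F. u \<in> f}"
    proof -
      have "(\<Prod>e\<in>F. chi e {u}) = (\<Prod>e\<in>F. if u \<in> e then -1 else 1)"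
        using finf by (intro prod.cong refl) (auto simp: chi_eq_power)
      also have "\<dots> = (-1) ^ card {f \<in> F. u \<in> f}"
        using finF by (simp add: prod.If_cases Int_def)
      finally show ?thesis .
    qed
    ultimately have "chi S {u} * (\<Prod>e\<in>F. chi e {u}) = -1"
      using mismatch by auto
    then have flip: "chi S x * chi S {u} * ((\<Prod>e\<in>F. chi e x) * (\<Prod>e\<in>F. chi e {u})) = - (chi S x * (\<Prod>e\<in>F. chi e x))" for x
      by (metis (no_types, lifting) mult.assoc mult.left_commute mult_minus1_right)
    have "(\<Sum>x\<in>Pow V. chi S x * (\<Prod>e\<in>F. chi e x)) = 0"
      using u by (rule sum_Pow_flip) (simp only: chi_sym_diff_right prod.distrib flip)
    with nzF show False by simp
  qed
  with R F that show ?thesis by blast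
qed

lemma corr_empty: "cubic_graph V E \<Longrightarrow> corr V E \<beta> \<gamma> {} = 1"
  by (subst corr_eq) (auto simp: boundary_def card_Pow cubic_graphD(1))

section \<open>Parity and 2-independence\<close>

lemma graph_dist_le: "(u, v) \<in> {(a, b). {a, b} \<in> E} ^^ k \<Longrightarrow> graph_dist E u v \<le> enat k"
  unfolding graph_dist_def by (rule INF_lower) simp

lemma graph_dist_refl: "graph_dist E u u = 0"
  using graph_dist_le[of u u 0 E] by (simp add: zero_enat_def[symmetric])

lemma graph_dist_edge: "{u, v} \<in> E \<Longrightarrow> graph_dist E u v \<le> 1"
  using graph_dist_le[of u v 1 E] by (simp add: one_enat_def)

lemma graph_dist_path2: "{u, w} \<in> E \<Longrightarrow> {w, v} \<in> E \<Longrightarrow> graph_dist E u v \<le> 2"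
  using graph_dist_le[of u v 2 E] by (auto simp: numeral_eq_enat[of "num.Bit0 num.One"] eval_nat_numeral(2))

text \<open>The two consequences of distance at least 3 used below: distinct members of
  \<open>V0\<close> are neither adjacent nor joined through a common neighbour.\<close>

lemma two_independentD:
  assumes "two_independent V E V0" "v \<in> V0" "w \<in> V0"
  shows "{v, w} \<in> E \<Longrightarrow> v = w" "{v, u} \<in> E \<Longrightarrow> {u, w} \<in> E \<Longrightarrow> v = w"
proof -
  have far: "3 \<le> graph_dist E v w" if "v \<noteq> w" using assms that by (auto simp: two_independent_def)
  have *: "\<not> (3::enat) \<le> 1" "\<not> (3::enat) \<le> 2" by simp_all
  show "{v, w} \<in> E \<Longrightarrow> v = w"
    using far order_trans[OF far graph_dist_edge] * by blast
  show "{v, u} \<in> E \<Longrightarrow> {u, w} \<in> E \<Longrightarrow> v = w"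
    using far order_trans[OF far graph_dist_path2] * by blast
qed

lemma cubic_edge_cases:
  assumes "cubic_graph V E" "f \<in> E" "a \<in> f"
  obtains b where "f = {a, b}" "b \<noteq> a" "a \<in> V" "b \<in> V"
proof -
  from cubic_graphD(4)[OF assms(1,2)] obtain x y where "f = {x, y}" "x \<noteq> y"
    by (auto simp: card_2_iff)
  with assms(3) cubic_graphD(3)[OF assms(1,2)] show ?thesis
    using that[of x] that[of y] by auto
qed

lemma insert_inter_card_1:
  assumes "card ({u, r} \<inter> R) = 1" "u \<notin> R"
  shows "r \<in> R"
  using assms by (cases "r \<in> R") auto

text \<open>Odd degree gives an edge of \<open>F\<close> from \<open>t\<close> to some
  \<open>u\<close> outside \<open>T\<close>. If \<open>u\<close> is not in \<open>D\<close>, it has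
  even degree, so a second edge of \<open>F\<close> leads on to some \<open>r\<close>; it crosses
  \<open>R\<close>, which puts \<open>r\<close> in \<open>R\<close>, and 2-independence keeps
  \<open>r\<close> out of \<open>T\<close>, leaving only \<open>D\<close>. The set \<open>D\<close>
  will be an edge or empty.\<close>

lemma parity_edge:
  assumes G: "cubic_graph V E" and I: "two_independent V E V0" and T: "T \<subseteq> V0"
    and R: "R \<subseteq> S" and F: "F \<subseteq> boundary E R"
    and parity: "\<And>u. u \<in> V \<Longrightarrow> odd (card {f \<in> F. u \<in> f}) \<longleftrightarrow> u \<in> S"
    and S: "S \<subseteq> T \<union> D" "T - D \<subseteq> S" and t: "t \<in> T - D"
  obtains x y where "{x, y} \<in> F" "x \<in> D" "y \<notin> D" "y = t \<or> {y, t} \<in> E"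
proof -
  have V0: "V0 \<subseteq> V" using I by (auto simp: two_independent_def)
  have FE: "f \<in> E" "card (f \<inter> R) = 1" if "f \<in> F" for f using F that by (auto simp: boundary_def)
  have "odd (card {f \<in> F. t \<in> f})" using parity[of t] t S T V0 by auto
  then have "{f \<in> F. t \<in> f} \<noteq> {}" by (intro notI) simp
  then obtain f where f: "f \<in> F" "t \<in> f" by auto
  obtain u where u: "f = {t, u}" "u \<noteq> t" "u \<in> V"
    using cubic_edge_cases[OF G FE(1)[OF f(1)] f(2)] by metis
  have tu: "{t, u} \<in> E" using FE(1) f u by auto
  have "u \<notin> T" using two_independentD(1)[OF I, of t u] t T tu u by auto
  show ?thesis
  proof (cases "u \<in> D")
    case True
    then show ?thesis using that[of u t] f u t by (auto simp: insert_commute)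
  next
    case False
    have "u \<notin> S" using False \<open>u \<notin> T\<close> S by auto
    then have "even (card {f \<in> F. u \<in> f})" using parity[OF u(3)] by simp
    then have "{f \<in> F. u \<in> f} \<noteq> {f}" by (intro notI) simp
    then obtain f' where f': "f' \<in> F" "u \<in> f'" "f' \<noteq> f" using f u by auto
    obtain r where r: "f' = {u, r}" "r \<noteq> u"
      using cubic_edge_cases[OF G FE(1)[OF f'(1)] f'(2)] by metis
    have ur: "{u, r} \<in> E" using FE(1) f' r by auto
    \<comment> \<open>\<open>u\<close> is outside \<open>S\<close> and hence outside
      \<open>R\<close>, so the cut edge must have its other end in \<open>R\<close>.\<close>
    have "r \<in> R" using FE(2)[OF f'(1)] \<open>u \<notin> S\<close> R r by (auto intro: insert_inter_card_1)
    have "r \<noteq> t" using f' r u by (auto simp: insert_commute)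
    have "r \<notin> T" using two_independentD(2)[OF I, of t r u] t T tu ur \<open>r \<noteq> t\<close> by auto
    with \<open>r \<in> R\<close> R S have "r \<in> D" by auto
    then show ?thesis using that[of r u] f' r False tu by (auto simp: insert_commute)
  qed
qed

text \<open>The edges found for different members of \<open>T - D\<close> are different: the outer
  end is \<open>t\<close> itself or a neighbour of \<open>t\<close>, so a shared edge would put two
  members of \<open>V0\<close> within distance 2.\<close>

lemma card_le_parity_edges:
  assumes G: "cubic_graph V E" and I: "two_independent V E V0" and T: "T \<subseteq> V0"
    and R: "R \<subseteq> S" and F: "F \<subseteq> boundary E R"
    and parity: "\<And>u. u \<in> V \<Longrightarrow> odd (card {f \<in> F. u \<in> f}) \<longleftrightarrow> u \<in> S"
    and S: "S \<subseteq> T \<union> D" "T - D \<subseteq> S"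
  shows "card (T - D) \<le> card {f \<in> F. \<exists>x\<in>D. \<exists>y. y \<notin> D \<and> f = {x, y}}"
proof -
  have "\<exists>x y. {x, y} \<in> F \<and> x \<in> D \<and> y \<notin> D \<and> (y = t \<or> {y, t} \<in> E)" if "t \<in> T - D" for t
    using parity_edge[OF G I T R F parity S that] by metis
  then obtain x y where xy: "\<And>t. t \<in> T - D \<Longrightarrow> {x t, y t} \<in> F \<and> x t \<in> D \<and> y t \<notin> D \<and> (y t = t \<or> {y t, t} \<in> E)"
    by metis
  have "inj_on (\<lambda>t. {x t, y t}) (T - D)"
  proof (rule inj_onI)
    fix t s assume ts: "t \<in> T - D" "s \<in> T - D" and "{x t, y t} = {x s, y s}"
    \<comment> \<open>An edge determines its outer end, since the other end lies in
      \<open>D\<close>.\<close>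
    then have "y t = y s" using xy[of t] xy[of s] by (auto simp: doubleton_eq_iff)
    moreover have "t \<in> V0" "s \<in> V0" using ts T by auto
    ultimately show "t = s"
      using xy[OF ts(1)] xy[OF ts(2)] two_independentD[OF I, of t s] two_independentD[OF I, of s t]
      by (metis insert_commute)
  qed
  moreover have "finite F" using F cubic_graphD(2)[OF G] by (auto simp: boundary_def intro: finite_subset)
  ultimately show ?thesis
    using xy by (intro card_inj_on_le[of "\<lambda>t. {x t, y t}"]) auto
qed

text \<open>For \<open>D = {}\<close> the edge supplied by \<open>parity_edge\<close> would need an
  end in the empty set. This is what makes the measurement outcomes on \<open>V0\<close>
  uniform.\<close>

lemma corr_two_independent:
  assumes G: "cubic_graph V E" and I: "two_independent V E V0" and T: "T \<subseteq> V0" "T \<noteq> {}"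
  shows "corr V E \<beta> \<gamma> T = 0"
proof (rule ccontr)
  assume nz: "corr V E \<beta> \<gamma> T \<noteq> 0"
  have TV: "T \<subseteq> V" using T I by (auto simp: two_independent_def)
  obtain R F where RF: "R \<subseteq> T" "F \<subseteq> boundary E R" "\<And>u. u \<in> V \<Longrightarrow> odd (card {f \<in> F. u \<in> f}) \<longleftrightarrow> u \<in> T"
    using corr_nonzero[OF G TV nz] by blast
  obtain t where "t \<in> T" using T by auto
  then show False using parity_edge[OF G I T(1) RF, of "{}" t] by auto
qed

lemma card_sym_diff_parity:
  assumes "finite A" "finite B"
  shows "even (card (sym_diff A B)) \<longleftrightarrow> even (card A + card B)"
proof -
  have "card A = card (A - B) + card (A \<inter> B)" "card B = card (B - A) + card (A \<inter> B)"
    using assms by (subst card_Un_disjoint[symmetric]; auto intro!: arg_cong[of _ _ card])+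
  moreover have "card (sym_diff A B) = card (A - B) + card (B - A)"
    using assms by (intro card_Un_disjoint) auto
  ultimately show ?thesis by presburger
qed

text \<open>Counting the edges of \<open>F\<close> that leave \<open>e\<close> bounds
  \<open>card T\<close> by 2, and a handshake argument makes it even. The distance bound comes from
  \<open>parity_edge\<close>, which joins \<open>t\<close> to an end of \<open>e\<close> by at most
  two edges.\<close>

lemma corr_edge_nonzero:
  assumes G: "cubic_graph V E" and I: "two_independent V E V0" and T: "T \<subseteq> V0" and e: "e \<in> E"
    and nz: "corr V E \<beta> \<gamma> (sym_diff e T) \<noteq> 0"
  shows "card T = 0 \<or> card T = 2" "t \<in> T \<Longrightarrow> edge_dist E t e \<le> 2"
proof -
  note G' = cubic_graphD[OF G]
  define S where "S = sym_diff e T"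
  have TV: "T \<subseteq> V" using T I by (auto simp: two_independent_def)
  then have finT: "finite T" using G'(1) finite_subset by blast
  have SV: "S \<subseteq> V" using TV G'(3)[OF e] by (auto simp: S_def)
  obtain R F where R: "R \<subseteq> S" and F: "F \<subseteq> boundary E R"
    and parity: "\<And>u. u \<in> V \<Longrightarrow> odd (card {f \<in> F. u \<in> f}) \<longleftrightarrow> u \<in> S"
    using corr_nonzero[OF G SV] nz by (metis S_def)
  have FE: "f \<in> E" "card (f \<inter> R) = 1" if "f \<in> F" for f using F that by (auto simp: boundary_def)
  have finF: "finite F" using F G'(2) by (auto simp: boundary_def intro: finite_subset)
  have S: "S \<subseteq> T \<union> e" "T - e \<subseteq> S" by (auto simp: S_def)
  \<comment> \<open>Handshake: the degrees in \<open>F\<close> have even sum, so the set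
    \<open>S\<close> of odd vertices has even size, and its size has the parity of
    \<open>card T + 2\<close>.\<close>
  have even_T: "even (card T)"
  proof -
    have "(\<Sum>u\<in>V. card {f \<in> F. u \<in> f}) = (\<Sum>f\<in>F. card {u \<in> V. u \<in> f})"
      using sum_multicount_gen[OF G'(1) finF, of "\<lambda>u f. u \<in> f"] by simp
    also have "\<dots> = (\<Sum>f\<in>F. 2)"
    proof (intro sum.cong refl)
      fix f assume "f \<in> F"
      then have "{u \<in> V. u \<in> f} = f" "card f = 2" using G'(3,4) FE(1) by blast+
      then show "card {u \<in> V. u \<in> f} = 2" by simp
    qed
    finally have "even (\<Sum>u\<in>V. card {f \<in> F. u \<in> f})" by simp
    then have "even (card {u \<in> V. odd (card {f \<in> F. u \<in> f})})" using G'(1) by (simp add: even_sum_iff)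
    also have "{u \<in> V. odd (card {f \<in> F. u \<in> f})} = S" using parity SV by auto
    finally show ?thesis
      using card_sym_diff_parity[OF G'(5)[OF e] finT] G'(4)[OF e] by (simp add: S_def)
  qed
  obtain a where "a \<in> e" using G'(4)[OF e] by fastforce
  then obtain b where ab: "e = {a, b}" "b \<noteq> a" "a \<in> V" "b \<in> V" using cubic_edge_cases[OF G e] by metis
  \<comment> \<open>The edges of \<open>F\<close> at \<open>v\<close> other than \<open>e\<close>;
    3-regularity allows at most two.\<close>
  define B where "B v = {f \<in> F. v \<in> f \<and> f \<noteq> e}" for v
  have finB: "finite (B v)" for v using finF by (simp add: B_def)
  have deg: "card {f \<in> F. v \<in> f} = card (B v) + of_bool (e \<in> F)" if "v \<in> e" for v
  proof -
    have "{f \<in> F. v \<in> f} = (if e \<in> F then insert e (B v) else B v)" using that by (auto simp: B_def)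
    then show ?thesis using finB by (auto simp: B_def)
  qed
  have B_le: "card (B v) \<le> 2" if "v \<in> e" for v
  proof -
    have "B v \<subseteq> {f \<in> E. v \<in> f} - {e}" using FE by (auto simp: B_def)
    then have "card (B v) \<le> card ({f \<in> E. v \<in> f} - {e})" using G'(2) by (intro card_mono) auto
    also have "\<dots> = 2" using that e G'(3)[OF e] G'(6)[of v] by (subst card_Diff_singleton) auto
    finally show ?thesis .
  qed
  \<comment> \<open>If \<open>v\<close> is not in \<open>R\<close>, the far end of such an edge is
    in \<open>R\<close> but not in \<open>e\<close>, hence in \<open>T\<close>.\<close>
  have nbr: "\<exists>r\<in>T. f = {v, r} \<and> {v, r} \<in> E" if "v \<in> e" "v \<notin> R" "f \<in> B v" for v f
  proof -
    have f: "f \<in> F" "v \<in> f" "f \<noteq> e" using that by (auto simp: B_def)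
    obtain r where r: "f = {v, r}" "r \<noteq> v"
      using cubic_edge_cases[OF G FE(1)[OF f(1)] f(2)] by metis
    have "r \<in> R" using FE(2)[OF f(1)] that r by (auto intro: insert_inter_card_1)
    moreover have "r \<notin> e" using ab that f r by (auto simp: insert_commute)
    ultimately have "r \<in> T" using R S by auto
    then show ?thesis using r f FE(1) by auto
  qed
  \<comment> \<open>Two such edges would make \<open>v\<close> a common neighbour of two members of
    \<open>T\<close>.\<close>
  have B_le1: "card (B v) \<le> 1" if v: "v \<in> e" "v \<notin> R" for v
  proof -
    have "f = f'" if ff: "f \<in> B v" "f' \<in> B v" for f f'
    proof -
      obtain r r' where "r \<in> T" "r' \<in> T" "f = {v, r}" "f' = {v, r'}" "{v, r} \<in> E" "{v, r'} \<in> E"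
        using nbr[OF v ff(1)] nbr[OF v ff(2)] by blast
      then show ?thesis using two_independentD(2)[OF I, of r r' v] T by (auto simp: insert_commute)
    qed
    then show ?thesis using card_le_Suc0_iff_eq[OF finB] by auto
  qed
  \<comment> \<open>An end of \<open>e\<close> in \<open>T\<close> cancels from the symmetric
    difference, so it lies outside \<open>R\<close>; a remaining edge would join it to another
    member of \<open>T\<close>.\<close>
  have B_0: "card (B v) = 0" if "v \<in> e" "v \<in> T" for v
  proof -
    have "v \<notin> R" using that R by (auto simp: S_def)
    have False if f: "f \<in> B v" for f
    proof -
      obtain r where r: "r \<in> T" "f = {v, r}" "{v, r} \<in> E" using nbr[OF \<open>v \<in> e\<close> \<open>v \<notin> R\<close> f] by auto
      then have "r = v" using two_independentD(1)[OF I, of v r] that T \<open>v \<in> T\<close> by auto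
      then show False using r G'(4) by fastforce
    qed
    then show ?thesis using finB by auto
  qed
  have "card (T - e) \<le> card {f \<in> F. \<exists>x\<in>e. \<exists>y. y \<notin> e \<and> f = {x, y}}"
    by (rule card_le_parity_edges[OF G I T R F parity S])
  also have "\<dots> \<le> card (B a \<union> B b)"
    using finB ab by (intro card_mono) (auto simp: B_def)
  also have "\<dots> \<le> card (B a) + card (B b)" by (rule card_Un_le)
  finally have le: "card (T - e) \<le> card (B a) + card (B b)" .
  \<comment> \<open>If the end \<open>p\<close> is in \<open>T\<close>, its degree is even and
    \<open>B p\<close> is empty, so \<open>e\<close> is not in \<open>F\<close>. The other end
    \<open>q\<close> then has an odd number, hence exactly one, of remaining edges.\<close>
  have one: "card T \<le> 2" if pq: "e = {p, q}" "p \<noteq> q" "p \<in> T" for p q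
  proof -
    have "q \<notin> T" using two_independentD(1)[OF I, of p q] pq T e by auto
    have V: "p \<in> V" "q \<in> V" using pq ab by auto
    have "e \<notin> F" using parity[OF V(1)] deg[of p] B_0[of p] pq by (auto simp: S_def)
    then have "odd (card (B q))" using parity[OF V(2)] deg[of q] pq \<open>q \<notin> T\<close> by (auto simp: S_def)
    moreover have "card (B q) \<le> 2" using B_le pq by simp
    ultimately have "card (B q) = 1" by presburger
    moreover have "card (B a) + card (B b) = card (B p) + card (B q)" using ab pq by (auto simp: doubleton_eq_iff)
    ultimately have "card (T - e) \<le> 1" using le B_0[of p] pq by simp
    moreover have "card T = card (T - e) + card (T \<inter> e)"
      using finT by (subst card_Un_disjoint[symmetric]) (auto intro!: arg_cong[of _ _ card])
    moreover have "T \<inter> e = {p}" using pq \<open>q \<notin> T\<close> by auto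
    ultimately show ?thesis by simp
  qed
  \<comment> \<open>If \<open>T\<close> avoids \<open>e\<close>, both ends of \<open>e\<close> lie
    in \<open>S\<close> and have odd degree in \<open>F\<close>.\<close>
  have two: "card T \<le> 2" if ne: "a \<notin> T" "b \<notin> T"
  proof -
    have odd: "odd (card (B a) + of_bool (e \<in> F))" "odd (card (B b) + of_bool (e \<in> F))"
    proof -
      have "odd (card (B v) + of_bool (e \<in> F))" if v: "v \<in> e" "v \<notin> T" for v
      proof -
        have "v \<in> S" "v \<in> V" using v G'(3)[OF e] by (auto simp: S_def)
        then show ?thesis using parity[of v] deg[OF v(1)] by metis
      qed
      then show "odd (card (B a) + of_bool (e \<in> F))" "odd (card (B b) + of_bool (e \<in> F))"
        using ab ne by auto
    qed
    have B2: "card (B a) \<le> 2" "card (B b) \<le> 2" using B_le ab by auto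
    \<comment> \<open>If \<open>e\<close> is in \<open>F\<close>, both counts are even, and the end
      outside \<open>R\<close> has at most one such edge, hence none. If \<open>e\<close> is not in
      \<open>F\<close>, both counts are odd and at most 2, hence 1.\<close>
    have "card (B a) + card (B b) \<le> 2"
    proof (cases "e \<in> F")
      case True
      then have "card ({a, b} \<inter> R) = 1" using FE(2) ab by auto
      then have "a \<notin> R \<or> b \<notin> R" using ab by (auto simp: Int_insert_left)
      then have "card (B a) \<le> 1 \<or> card (B b) \<le> 1" using B_le1 ab by auto
      moreover have "even (card (B a))" "even (card (B b))" using odd True by auto
      ultimately have "card (B a) = 0 \<or> card (B b) = 0" by presburger
      then show ?thesis using B2 by auto
    next
      case False
      then have "odd (card (B a))" "odd (card (B b))" using odd by auto
      then have "card (B a) = 1" "card (B b) = 1" using B2 by presburger+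
      then show ?thesis by simp
    qed
    moreover have "T - e = T" using ne ab by auto
    ultimately show ?thesis using le by simp
  qed
  have "card T \<le> 2" using one[of a b] one[of b a] two ab by (auto simp: insert_commute)
  then show "card T = 0 \<or> card T = 2" using even_T by presburger
  have dist: "edge_dist E t e \<le> 2" if "x \<in> e" "graph_dist E t x \<le> 2" for x t
    using that G'(5)[OF e] unfolding edge_dist_def by (meson Min_le finite_imageI imageI order_trans)
  show "edge_dist E t e \<le> 2" if t: "t \<in> T"
  proof (cases "t \<in> e")
    case True
    then show ?thesis by (rule dist) (simp add: graph_dist_refl)
  next
    case False
    with t have "t \<in> T - e" by simp
    then obtain x y where xy: "{x, y} \<in> F" "x \<in> e" "y = t \<or> {y, t} \<in> E"
      using parity_edge[OF G I T R F parity S] by metis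
    then have "{x, y} \<in> E" using FE(1) by auto
    then have "graph_dist E t x \<le> 2"
      using xy(3) graph_dist_edge[of t x E] graph_dist_path2[of t y E x]
      by (auto simp: insert_commute intro: order_trans)
    then show ?thesis by (rule dist[OF xy(2)])
  qed
qed

section \<open>Projection onto outcomes\<close>

definition proj_weight :: "'a set \<Rightarrow> ('a \<Rightarrow> real) \<Rightarrow> 'a set \<Rightarrow> complex" where
  "proj_weight V0 \<sigma> x = (\<Prod>v\<in>V0. (1 + of_real (\<sigma> v) * spin v x) / 2)"

lemma meas_proj_diagonal: "finite V0 \<Longrightarrow> meas_proj V0 \<sigma> \<psi> = (\<lambda>x. proj_weight V0 \<sigma> x * \<psi> x)"
  unfolding meas_proj_def proj_weight_def
  by (rule op_prod_diagonal) (auto simp: pauli_Z_diagonal algebra_simps)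

lemma cnj_proj_weight [simp]: "cnj (proj_weight V0 \<sigma> x) = proj_weight V0 \<sigma> x"
  by (simp add: proj_weight_def)

text \<open>For signs \<open>\<sigma> v\<close> every factor is 0 or 1.\<close>

lemma proj_weight_idem:
  assumes "\<And>v. v \<in> V0 \<Longrightarrow> \<sigma> v \<in> {-1, 1}"
  shows "proj_weight V0 \<sigma> x * proj_weight V0 \<sigma> x = proj_weight V0 \<sigma> x"
proof -
  have "(1 + of_real (\<sigma> v) * spin v x) / 2 * ((1 + of_real (\<sigma> v) * spin v x) / 2) = (1 + of_real (\<sigma> v) * spin v x) / 2"
    if "v \<in> V0" for v
    using assms[OF that] by (auto simp: spin_def)
  then show ?thesis unfolding proj_weight_def prod.distrib[symmetric] by (rule prod.cong[OF refl])
qed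

lemma proj_weight_expand:
  assumes "finite V0"
  shows "proj_weight V0 \<sigma> x = (\<Sum>T\<in>Pow V0. of_real (\<Prod>v\<in>T. \<sigma> v) * chi T x) / 2 ^ card V0"
proof -
  have "proj_weight V0 \<sigma> x = (\<Prod>v\<in>V0. of_real (\<sigma> v) * spin v x + 1) / 2 ^ card V0"
    by (simp add: proj_weight_def prod_dividef add.commute)
  then show ?thesis
    unfolding prod_add[OF assms] by (simp add: chi_def prod.distrib)
qed

lemma maxcut_diagonal:
  assumes "cubic_graph V E"
  shows "maxcut E \<psi> = (\<lambda>x. (\<Sum>e\<in>E. (1 - chi e x) / 2) * \<psi> x)"
  using cubic_graphD(5)[OF assms]
  by (intro ext) (auto simp: maxcut_def op_sum_def op_prod_pauli_Z sum_distrib_right left_diff_distrib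
      intro!: sum.cong)

text \<open>The sum runs over all edges, which avoids distances in the algorithm; edges far from
  either vertex contribute zero, as \<open>coupling_pair\<close> shows. Taking real parts loses
  nothing, because the correlators are real.\<close>

definition coupling :: "'a set \<Rightarrow> 'a set set \<Rightarrow> 'a set \<Rightarrow> real \<Rightarrow> real \<Rightarrow> 'a set \<Rightarrow> real" where
  "coupling V E V0 \<beta> \<gamma> q = - (1 / 2) * (\<Sum>e\<in>E. Re (corr V E \<beta> \<gamma> (sym_diff e q)))"

lemma of_real_Re_corr: "complex_of_real (Re (corr V E \<beta> \<gamma> S)) = corr V E \<beta> \<gamma> S"
proof -
  have "cnj (corr V E \<beta> \<gamma> S) = corr V E \<beta> \<gamma> S" by (simp add: corr_def mult_ac)
  then show ?thesis by (metis Reals_cnj_iff of_real_Re)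
qed

context
  fixes V :: "'a set" and E V0 and \<beta> \<gamma> :: real
  assumes G: "cubic_graph V E" and I: "two_independent V E V0"
begin

text \<open>The projector expands into Z strings on subsets of \<open>V0\<close>, and Z strings
  multiply by symmetric difference, so every projected expectation is a combination of
  correlators.\<close>

lemma sum_chi_proj:
  assumes "S \<subseteq> V"
  shows "(\<Sum>x\<in>Pow V. chi S x * proj_weight V0 \<sigma> x * (cnj (qaoa1 V E \<beta> \<gamma> x) * qaoa1 V E \<beta> \<gamma> x))
    = (\<Sum>T\<in>Pow V0. of_real (\<Prod>v\<in>T. \<sigma> v) * corr V E \<beta> \<gamma> (sym_diff S T)) / 2 ^ card V0"
proof -
  have V0: "V0 \<subseteq> V" using I by (simp add: two_independent_def)
  have fin: "finite T" if "T \<subseteq> V" for T using that cubic_graphD(1)[OF G] finite_subset by blast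
  have "corr V E \<beta> \<gamma> (sym_diff S T) = (\<Sum>x\<in>Pow V. chi S x * chi T x * (cnj (qaoa1 V E \<beta> \<gamma> x) * qaoa1 V E \<beta> \<gamma> x))" if "T \<in> Pow V0" for T
    using that V0 assms unfolding corr_def by (subst chi_sym_diff_left) (auto intro: fin)
  then have "(\<Sum>T\<in>Pow V0. of_real (\<Prod>v\<in>T. \<sigma> v) * corr V E \<beta> \<gamma> (sym_diff S T))
    = (\<Sum>T\<in>Pow V0. of_real (\<Prod>v\<in>T. \<sigma> v) * (\<Sum>x\<in>Pow V. chi S x * chi T x * (cnj (qaoa1 V E \<beta> \<gamma> x) * qaoa1 V E \<beta> \<gamma> x)))"
    by (intro sum.cong refl) (simp only:)
  also have "\<dots> = (\<Sum>x\<in>Pow V. \<Sum>T\<in>Pow V0. chi S x * (of_real (\<Prod>v\<in>T. \<sigma> v) * chi T x) * (cnj (qaoa1 V E \<beta> \<gamma> x) * qaoa1 V E \<beta> \<gamma> x))"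
    unfolding sum_distrib_left by (subst sum.swap) (simp only: mult_ac)
  finally show ?thesis
    unfolding proj_weight_expand[OF fin[OF V0]]
    by (simp only: sum_divide_distrib sum_distrib_left sum_distrib_right times_divide_eq_right times_divide_eq_left)
qed

lemma expval_maxcut: "expval V (qaoa1 V E \<beta> \<gamma>) (maxcut E) = (\<Sum>e\<in>E. (1 - corr V E \<beta> \<gamma> e) / 2)"
proof -
  \<comment> \<open>The factor \<open>chi {} x\<close> lets the constant part of each edge term be
    read as the correlator of the empty set.\<close>
  have "expval V (qaoa1 V E \<beta> \<gamma>) (maxcut E) = (\<Sum>x\<in>Pow V. \<Sum>e\<in>E. (chi {} x * (cnj (qaoa1 V E \<beta> \<gamma> x) * qaoa1 V E \<beta> \<gamma> x) - chi e x * (cnj (qaoa1 V E \<beta> \<gamma> x) * qaoa1 V E \<beta> \<gamma> x)) / 2)"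
    by (simp add: expval_def braket_def maxcut_diagonal[OF G] sum_distrib_left sum_distrib_right algebra_simps diff_divide_distrib)
  also have "\<dots> = (\<Sum>e\<in>E. (corr V E \<beta> \<gamma> {} - corr V E \<beta> \<gamma> e) / 2)"
    unfolding corr_def sum_subtractf[symmetric] sum_divide_distrib by (rule sum.swap)
  finally show ?thesis by (simp add: corr_empty[OF G])
qed

context
  fixes \<sigma> :: "'a \<Rightarrow> real"
  assumes \<sigma>: "\<forall>v\<in>V0. \<sigma> v \<in> {-1, 1}"
begin

lemma finite_V0: "finite V0"
  using I cubic_graphD(1)[OF G] by (auto simp: two_independent_def intro: finite_subset)

text \<open>Every outcome is equally likely: of the expanded projector only the empty string has a
  nonzero correlator.\<close>

lemma ket_norm_meas_proj: "complex_of_real ((ket_norm V (meas_proj V0 \<sigma> (qaoa1 V E \<beta> \<gamma>)))\<^sup>2) = 1 / 2 ^ card V0"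
proof -
  have "complex_of_real ((ket_norm V (meas_proj V0 \<sigma> (qaoa1 V E \<beta> \<gamma>)))\<^sup>2)
      = (\<Sum>x\<in>Pow V. complex_of_real ((cmod (proj_weight V0 \<sigma> x * qaoa1 V E \<beta> \<gamma> x))\<^sup>2))"
    unfolding ket_norm_def meas_proj_diagonal[OF finite_V0] of_real_sum[symmetric]
    by (subst real_sqrt_pow2) (auto intro: sum_nonneg)
  also have "\<dots> = (\<Sum>x\<in>Pow V. chi {} x * proj_weight V0 \<sigma> x * (cnj (qaoa1 V E \<beta> \<gamma> x) * qaoa1 V E \<beta> \<gamma> x))"
  proof (intro sum.cong refl)
    fix x
    have "complex_of_real ((cmod (proj_weight V0 \<sigma> x * qaoa1 V E \<beta> \<gamma> x))\<^sup>2)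
       = (proj_weight V0 \<sigma> x * proj_weight V0 \<sigma> x) * (cnj (qaoa1 V E \<beta> \<gamma> x) * qaoa1 V E \<beta> \<gamma> x)"
      unfolding complex_norm_square by (simp add: mult_ac)
    then show "complex_of_real ((cmod (proj_weight V0 \<sigma> x * qaoa1 V E \<beta> \<gamma> x))\<^sup>2)
      = chi {} x * proj_weight V0 \<sigma> x * (cnj (qaoa1 V E \<beta> \<gamma> x) * qaoa1 V E \<beta> \<gamma> x)"
      using \<sigma> by (simp add: proj_weight_idem)
  qed
  also have "\<dots> = (\<Sum>T\<in>Pow V0. of_real (\<Prod>v\<in>T. \<sigma> v) * corr V E \<beta> \<gamma> T) / 2 ^ card V0"
    by (subst sum_chi_proj) simp_all
  also have "(\<Sum>T\<in>Pow V0. of_real (\<Prod>v\<in>T. \<sigma> v) * corr V E \<beta> \<gamma> T) = (\<Sum>T\<in>{{}}. of_real (\<Prod>v\<in>T. \<sigma> v) * corr V E \<beta> \<gamma> T)"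
    using finite_V0 by (intro sum.mono_neutral_right) (auto simp: corr_two_independent[OF G I])
  finally show ?thesis by (simp add: corr_empty[OF G])
qed

text \<open>\<open>maxcut\<close> and the projector are both diagonal, so the two projectors merge
  into one. The constant part of each edge keeps only \<open>T = {}\<close>, whereas the ZZ part
  still involves all subsets.\<close>

lemma expval_meas_maxcut:
  "expval V (qaoa1 V E \<beta> \<gamma>) (meas_proj V0 \<sigma> \<circ> maxcut E \<circ> meas_proj V0 \<sigma>)
    = (\<Sum>e\<in>E. (1 - (\<Sum>T\<in>Pow V0. of_real (\<Prod>v\<in>T. \<sigma> v) * corr V E \<beta> \<gamma> (sym_diff e T))) / 2) / 2 ^ card V0"
proof -
  have "expval V (qaoa1 V E \<beta> \<gamma>) (meas_proj V0 \<sigma> \<circ> maxcut E \<circ> meas_proj V0 \<sigma>)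
      = (\<Sum>x\<in>Pow V. (\<Sum>e\<in>E. (1 - chi e x) / 2) * (proj_weight V0 \<sigma> x * proj_weight V0 \<sigma> x) * (cnj (qaoa1 V E \<beta> \<gamma> x) * qaoa1 V E \<beta> \<gamma> x))"
    by (simp add: expval_def braket_def maxcut_diagonal[OF G] meas_proj_diagonal[OF finite_V0] mult_ac)
  also have "\<dots> = (\<Sum>x\<in>Pow V. \<Sum>e\<in>E. (chi {} x * proj_weight V0 \<sigma> x * (cnj (qaoa1 V E \<beta> \<gamma> x) * qaoa1 V E \<beta> \<gamma> x)
      - chi e x * proj_weight V0 \<sigma> x * (cnj (qaoa1 V E \<beta> \<gamma> x) * qaoa1 V E \<beta> \<gamma> x)) / 2)"
    using \<sigma> by (simp add: proj_weight_idem sum_distrib_left sum_distrib_right algebra_simps diff_divide_distrib)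
  also have "\<dots> = (\<Sum>e\<in>E. ((\<Sum>T\<in>Pow V0. of_real (\<Prod>v\<in>T. \<sigma> v) * corr V E \<beta> \<gamma> (sym_diff {} T)) / 2 ^ card V0
      - (\<Sum>T\<in>Pow V0. of_real (\<Prod>v\<in>T. \<sigma> v) * corr V E \<beta> \<gamma> (sym_diff e T)) / 2 ^ card V0) / 2)"
    by (subst sum.swap)
       (simp only: sum_chi_proj[OF empty_subsetI] sum_chi_proj[OF cubic_graphD(3)[OF G]] sum_subtractf flip: sum_divide_distrib cong: sum.cong)
  also have "(\<Sum>T\<in>Pow V0. of_real (\<Prod>v\<in>T. \<sigma> v) * corr V E \<beta> \<gamma> (sym_diff {} T))
      = (\<Sum>T\<in>{{}}. of_real (\<Prod>v\<in>T. \<sigma> v) * corr V E \<beta> \<gamma> T)"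
    using finite_V0 by (intro sum.mono_neutral_cong_right) (auto simp: corr_two_independent[OF G I])
  also have "(\<Sum>e\<in>E. ((\<Sum>T\<in>{{}}. of_real (\<Prod>v\<in>T. \<sigma> v) * corr V E \<beta> \<gamma> T) / 2 ^ card V0
      - (\<Sum>T\<in>Pow V0. of_real (\<Prod>v\<in>T. \<sigma> v) * corr V E \<beta> \<gamma> (sym_diff e T)) / 2 ^ card V0) / 2)
    = (\<Sum>e\<in>E. (1 - (\<Sum>T\<in>Pow V0. of_real (\<Prod>v\<in>T. \<sigma> v) * corr V E \<beta> \<gamma> (sym_diff e T))) / 2) / 2 ^ card V0"
    unfolding sum_divide_distrib[of _ E] by (simp add: corr_empty[OF G] diff_divide_distrib mult.commute)
  finally show ?thesis .
qed

text \<open>Uniformity cancels the normalisation. For each edge only the empty set and pairs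
  survive: the former reassembles the unconditioned expectation, and the latter give the couplings
  after exchanging the sums.\<close>

lemma conditional_expectation:
  "expval V (qaoa1 V E \<beta> \<gamma>) (meas_proj V0 \<sigma> \<circ> maxcut E \<circ> meas_proj V0 \<sigma>)
      / complex_of_real ((ket_norm V (meas_proj V0 \<sigma> (qaoa1 V E \<beta> \<gamma>)))\<^sup>2)
    = expval V (qaoa1 V E \<beta> \<gamma>) (maxcut E)
      + complex_of_real (\<Sum>q | q \<subseteq> V0 \<and> card q = 2. coupling V E V0 \<beta> \<gamma> q * (\<Prod>v\<in>q. \<sigma> v))"
proof -
  let ?s = "\<lambda>T. complex_of_real (\<Prod>v\<in>T. \<sigma> v)"
  let ?Q = "{q. q \<subseteq> V0 \<and> card q = 2}"
  have split: "(\<Sum>T\<in>Pow V0. ?s T * corr V E \<beta> \<gamma> (sym_diff e T))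
      = corr V E \<beta> \<gamma> e + (\<Sum>q\<in>?Q. ?s q * corr V E \<beta> \<gamma> (sym_diff e q))" if e: "e \<in> E" for e
  proof -
    have "(\<Sum>T\<in>Pow V0. ?s T * corr V E \<beta> \<gamma> (sym_diff e T)) = (\<Sum>T\<in>insert {} ?Q. ?s T * corr V E \<beta> \<gamma> (sym_diff e T))"
    proof (intro sum.mono_neutral_right ballI)
      fix T assume T: "T \<in> Pow V0 - insert {} ?Q"
      then have "finite T" using finite_V0 finite_subset by auto
      then have "\<not> (card T = 0 \<or> card T = 2)" using T by auto
      then show "?s T * corr V E \<beta> \<gamma> (sym_diff e T) = 0"
        using corr_edge_nonzero(1)[OF G I _ e, of T] T by (metis DiffD1 Pow_iff mult_zero_right)
    qed (use finite_V0 in auto)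
    also have "\<dots> = ?s {} * corr V E \<beta> \<gamma> (sym_diff e {}) + (\<Sum>q\<in>?Q. ?s q * corr V E \<beta> \<gamma> (sym_diff e q))"
      using finite_V0 by (intro sum.insert) auto
    finally show ?thesis by simp
  qed
  have "expval V (qaoa1 V E \<beta> \<gamma>) (meas_proj V0 \<sigma> \<circ> maxcut E \<circ> meas_proj V0 \<sigma>)
      / complex_of_real ((ket_norm V (meas_proj V0 \<sigma> (qaoa1 V E \<beta> \<gamma>)))\<^sup>2)
    = (\<Sum>e\<in>E. (1 - (\<Sum>T\<in>Pow V0. ?s T * corr V E \<beta> \<gamma> (sym_diff e T))) / 2)"
    unfolding ket_norm_meas_proj expval_meas_maxcut by simp
  also have "\<dots> = (\<Sum>e\<in>E. (1 - corr V E \<beta> \<gamma> e) / 2 - (\<Sum>q\<in>?Q. ?s q * corr V E \<beta> \<gamma> (sym_diff e q)) / 2)"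
    by (intro sum.cong refl) (simp only: split, simp add: diff_divide_distrib add_divide_distrib)
  also have "\<dots> = expval V (qaoa1 V E \<beta> \<gamma>) (maxcut E) - (\<Sum>q\<in>?Q. \<Sum>e\<in>E. ?s q * corr V E \<beta> \<gamma> (sym_diff e q) / 2)"
    unfolding expval_maxcut sum_subtractf sum.swap[of _ E ?Q] by (simp only: sum_divide_distrib)
  also have "(\<Sum>q\<in>?Q. \<Sum>e\<in>E. ?s q * corr V E \<beta> \<gamma> (sym_diff e q) / 2)
      = - complex_of_real (\<Sum>q\<in>?Q. coupling V E V0 \<beta> \<gamma> q * (\<Prod>v\<in>q. \<sigma> v))"
    unfolding coupling_def of_real_sum of_real_mult of_real_Re_corr
    by (simp add: of_real_Re_corr sum_distrib_left sum_distrib_right sum_divide_distrib mult_ac flip: sum_negf)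
  finally show ?thesis by (simp only: diff_minus_eq_add)
qed

end

text \<open>If \<open>e\<close> contains \<open>v\<close> or \<open>w\<close>, the repeated Z
  squares to the identity, which the symmetric difference accounts for.\<close>

lemma expval_edge_pair:
  assumes "e \<in> E" "v \<in> V0" "w \<in> V0" "v \<noteq> w"
  shows "expval V (qaoa1 V E \<beta> \<gamma>) (edge_ZZ e \<circ> pauli_Z v \<circ> pauli_Z w) = corr V E \<beta> \<gamma> (sym_diff e {v, w})"
  using assms cubic_graphD(5)[OF G assms(1)]
  by (simp add: expval_def braket_def corr_def op_prod_pauli_Z pauli_Z_diagonal chi_sym_diff_left)
     (simp add: chi_def mult_ac)

lemma coupling_pair:
  assumes vw: "v \<in> V0" "w \<in> V0" "v \<noteq> w"
  shows "complex_of_real (coupling V E V0 \<beta> \<gamma> {v, w})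
    = - (1 / 2) * (\<Sum>e | e \<in> E \<and> edge_dist E v e \<le> 2 \<and> edge_dist E w e \<le> 2.
        expval V (qaoa1 V E \<beta> \<gamma>) (edge_ZZ e \<circ> pauli_Z v \<circ> pauli_Z w))"
proof -
  have "complex_of_real (coupling V E V0 \<beta> \<gamma> {v, w}) = - (1 / 2) * (\<Sum>e\<in>E. corr V E \<beta> \<gamma> (sym_diff e {v, w}))"
    by (simp add: coupling_def of_real_Re_corr)
  also have "(\<Sum>e\<in>E. corr V E \<beta> \<gamma> (sym_diff e {v, w}))
     = (\<Sum>e | e \<in> E \<and> edge_dist E v e \<le> 2 \<and> edge_dist E w e \<le> 2. expval V (qaoa1 V E \<beta> \<gamma>) (edge_ZZ e \<circ> pauli_Z v \<circ> pauli_Z w))"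
  proof (intro sum.mono_neutral_cong_right ballI)
    fix e assume "e \<in> E - {e. e \<in> E \<and> edge_dist E v e \<le> 2 \<and> edge_dist E w e \<le> 2}"
    then show "corr V E \<beta> \<gamma> (sym_diff e {v, w}) = 0"
      using corr_edge_nonzero(2)[OF G I, of "{v, w}" e] vw by blast
  qed (use cubic_graphD(2)[OF G] vw in \<open>auto simp: expval_edge_pair\<close>)
  finally show ?thesis .
qed

end

section \<open>Programs\<close>

text \<open>In a labelling of \<open>S\<close> the vertices labelled 0 are those of \<open>S - R\<close>; a label \<open>\<plusminus>1\<close> puts a vertex
  into \<open>R\<close> and is its eigenvalue of \<open>Z\<close>.\<close>

definition angle :: "('b \<Rightarrow> 'b \<Rightarrow> bool) \<Rightarrow> ('b \<times> int) list \<Rightarrow> 'b \<Rightarrow> int" where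
  "angle A xs u = (\<Sum>(s, l)\<leftarrow>xs. if A u s then l else 0)"

text \<open>Contribution of qubit \<open>u\<close> after averaging over its two states: outside
  \<open>S\<close> a cosine, in \<open>S - R\<close> a sine whose factor \<open>\<i>\<close> is
  collected elsewhere. A vertex of \<open>R\<close> is already fixed by its label and contributes
  1.\<close>

definition vertex_factor :: "('b \<Rightarrow> 'b \<Rightarrow> bool) \<Rightarrow> real \<Rightarrow> ('b \<times> int) list \<Rightarrow> 'b \<Rightarrow> real" where
  "vertex_factor A \<gamma> xs u = (case map_of xs u of
     None \<Rightarrow> cos (\<gamma> * angle A xs u) | Some l \<Rightarrow> if l = 0 then sin (\<gamma> * angle A xs u) else 1)"

text \<open>The mixer coefficient of a vertex, again without its factor \<open>\<i>\<close>. A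
  nonzero label also carries the eigenvalue of Z and the factor 1/2 from averaging over that
  qubit.\<close>

definition label_weight :: "real \<Rightarrow> int \<Rightarrow> real" where
  "label_weight \<beta> l = (if l = 0 then cos \<beta> else - (of_int l / 2) * sin \<beta>)"

definition labellings :: "nat \<Rightarrow> int list list" where
  "labellings n = List.n_lists n [0, 1, -1]"

text \<open>The vertex type and the adjacency relation are left open, so that the same expression
  serves for graph vertices and for their indices in the input.\<close>

definition label_sum :: "('b \<Rightarrow> 'b \<Rightarrow> bool) \<Rightarrow> 'b set \<Rightarrow> real \<Rightarrow> real \<Rightarrow> 'b list \<Rightarrow> real" where
  "label_sum A U \<beta> \<gamma> ss =
     (\<Sum>ls\<leftarrow>labellings (length ss). (\<Prod>l\<leftarrow>ls. label_weight \<beta> l) * (\<Prod>u\<in>U. vertex_factor A \<gamma> (zip ss ls) u))"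

text \<open>A time-bounded correctness triple: termination within \<open>b\<close> steps in a memory
  satisfying \<open>Q\<close>.\<close>

definition runs :: "nat list list \<Rightarrow> real list \<Rightarrow> com \<Rightarrow> memory \<Rightarrow> nat \<Rightarrow> (memory \<Rightarrow> bool) \<Rightarrow> bool" where
  "runs T ps c s b Q \<longleftrightarrow> (\<exists>t s'. exec T ps c s t s' \<and> t \<le> b \<and> Q s')"

lemma step_eqs:
  "step T ps (NConst i k) s = ((fst s)(i := k), snd s)"
  "step T ps (NAdd i j k) s = ((fst s)(i := fst s j + fst s k), snd s)"
  "step T ps (NSub i j k) s = ((fst s)(i := fst s j - fst s k), snd s)"
  "step T ps (NRead i j k) s = ((fst s)(i := table_entry T (fst s j) (fst s k)), snd s)"
  "step T ps (RConst i q) s = (fst s, (snd s)(i := of_rat q))"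
  "step T ps (RAdd i j k) s = (fst s, (snd s)(i := snd s j + snd s k))"
  "step T ps (RScale i q) s = (fst s, (snd s)(i := of_rat q * snd s i))"
  "step T ps (RMul i l) s = (fst s, (snd s)(i := snd s i * (if l < length ps then ps ! l else 0)))"
  by (cases s; simp)+

lemma runs_Instr: "Q (step T ps a s) \<Longrightarrow> 1 \<le> b \<Longrightarrow> runs T ps (Instr a) s b Q"
  unfolding runs_def using exec_Instr by blast

lemma runs_Seq:
  assumes "runs T ps c s b Q" "\<And>s'. Q s' \<Longrightarrow> runs T ps d s' b' R" "b + b' \<le> b''"
  shows "runs T ps (Seq c d) s b'' R"
  using assms unfolding runs_def by (meson exec_Seq add_mono le_trans)

lemma runs_weaken:
  assumes "runs T ps c s b P" "\<And>s'. P s' \<Longrightarrow> Q s'" "b \<le> b'"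
  shows "runs T ps c s b' Q"
proof -
  obtain t s' where "exec T ps c s t s'" "t \<le> b" "P s'" using assms(1) unfolding runs_def by blast
  then show ?thesis unfolding runs_def using assms(2,3) by (intro exI[of _ t] exI[of _ s']) simp
qed

lemma runs_Seq_Instr:
  "runs T ps d (step T ps a s) b Q \<Longrightarrow> b + 1 \<le> b' \<Longrightarrow> runs T ps (Seq (Instr a) d) s b' Q"
  by (rule runs_Seq[where Q = "\<lambda>s'. s' = step T ps a s" and b = 1 and b' = b]) (auto intro: runs_Instr)

lemma runs_Cond:
  assumes "fst s i \<noteq> 0 \<Longrightarrow> runs T ps c s b Q" "fst s i = 0 \<Longrightarrow> runs T ps d s b Q" "b + 1 \<le> b'"
  shows "runs T ps (Cond i c d) s b' Q"
proof (cases "fst s i = 0")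
  case True
  then obtain t s' where "exec T ps d s t s'" "t \<le> b" "Q s'" using assms(2) unfolding runs_def by blast
  with True show ?thesis unfolding runs_def using assms(3)
    by (intro exI[of _ "t + 1"] exI[of _ s'] conjI exec_Cond_False) auto
next
  case False
  then obtain t s' where "exec T ps c s t s'" "t \<le> b" "Q s'" using assms(1) unfolding runs_def by blast
  with False show ?thesis unfolding runs_def using assms(3)
    by (intro exI[of _ "t + 1"] exI[of _ s'] conjI exec_Cond_True) auto
qed

text \<open>The loop counts register \<open>i\<close> down to zero; \<open>I j\<close> holds when it has reached \<open>j\<close>.\<close>

lemma runs_While:
  assumes "\<And>j s. I (Suc j) s \<Longrightarrow> runs T ps c s b (I j)" and I: "\<And>j s. I j s \<Longrightarrow> fst s i = j"
  shows "I n s \<Longrightarrow> n * (b + 1) + 1 \<le> b' \<Longrightarrow> runs T ps (While i c) s b' (I 0)"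
proof (induction n arbitrary: s b')
  case 0
  then have "exec T ps (While i c) s 1 s" using I by (intro exec_While_False) auto
  moreover have "1 \<le> b'" using 0 by simp
  ultimately show ?case using 0(1) unfolding runs_def by blast
next
  case (Suc n)
  obtain t s1 where s1: "exec T ps c s t s1" "t \<le> b" "I n s1"
    using assms(1)[OF Suc.prems(1)] by (auto simp: runs_def)
  obtain t' s2 where s2: "exec T ps (While i c) s1 t' s2" "t' \<le> n * (b + 1) + 1" "I 0 s2"
    using Suc.IH[OF s1(3) order_refl] by (auto simp: runs_def)
  have "exec T ps (While i c) s (t + t' + 1) s2"
    using I[OF Suc.prems(1)] s1(1) s2(1) by (intro exec_While_True) auto
  moreover have "t + t' + 1 \<le> b'" using s1(2) s2(2) Suc.prems(2) by simp
  ultimately show ?case using s2(3) unfolding runs_def by blast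
qed

text \<open>Registers below \<open>k\<close> hold the arguments, \<open>d\<close> receives the
  result, and registers above \<open>d\<close> are scratch space.\<close>

definition assigns :: "nat \<Rightarrow> nat \<Rightarrow> (nat list list \<Rightarrow> (nat \<Rightarrow> nat) \<Rightarrow> nat) \<Rightarrow> com \<Rightarrow> nat \<Rightarrow> bool" where
  "assigns k d f c b \<longleftrightarrow> (\<forall>T ps s m. (\<forall>i<k. fst s i = m i) \<longrightarrow>
     runs T ps c s b (\<lambda>s'. (\<forall>i<d. fst s' i = fst s i) \<and> snd s' = snd s \<and> fst s' d = f T m))"

text \<open>Any destination from \<open>k\<close> upwards is allowed, so intermediate results can be
  stacked.\<close>

definition nat_computable :: "nat \<Rightarrow> (nat list list \<Rightarrow> (nat \<Rightarrow> nat) \<Rightarrow> nat) \<Rightarrow> bool" where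
  "nat_computable k f \<longleftrightarrow> (\<forall>d\<ge>k. \<exists>c b. assigns k d f c b)"

text \<open>Register \<open>e\<close> is the accumulator, lower real registers are preserved and
  higher ones are scratch. The time is polynomial in the number of vertices, which is stored in
  table entry (0, 0).\<close>

definition scales ::
    "nat \<Rightarrow> nat \<Rightarrow> (nat list list \<Rightarrow> real \<Rightarrow> real \<Rightarrow> (nat \<Rightarrow> nat) \<Rightarrow> real) \<Rightarrow> com \<Rightarrow> nat poly \<Rightarrow> bool" where
  "scales k e f c p \<longleftrightarrow> (\<forall>T \<beta> \<gamma> s m. (\<forall>i<k. fst s i = m i) \<longrightarrow>
     runs T [cos \<beta>, sin \<beta>, cos \<gamma>, sin \<gamma>] c s (poly p (table_entry T 0 0))
       (\<lambda>s'. (\<forall>i<k. fst s' i = m i) \<and> (\<forall>i<e. snd s' i = snd s i) \<and> snd s' e = snd s e * f T \<beta> \<gamma> m))"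

text \<open>Values are computed by programs that multiply an accumulator by them, since the machine
  cannot multiply two computed real numbers.\<close>

definition real_computable ::
    "nat \<Rightarrow> (nat list list \<Rightarrow> real \<Rightarrow> real \<Rightarrow> (nat \<Rightarrow> nat) \<Rightarrow> real) \<Rightarrow> bool" where
  "real_computable k f \<longleftrightarrow> (\<forall>e. \<exists>c p. scales k e f c p)"

lemma runs_assigns:
  assumes "assigns k d f c b" "\<And>i. i < k \<Longrightarrow> fst s i = m i"
    and "\<And>s'. (\<And>i. i < d \<Longrightarrow> fst s' i = fst s i) \<Longrightarrow> snd s' = snd s \<Longrightarrow> fst s' d = f T m \<Longrightarrow> Q s'"
  shows "runs T ps c s b Q"
  by (rule runs_weaken[OF assms(1)[unfolded assigns_def, rule_format, OF assms(2)]]) (use assms(3) in auto)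

lemma runs_scales:
  assumes "scales k e f c p" "\<And>i. i < k \<Longrightarrow> fst s i = m i" "poly p (table_entry T 0 0) \<le> b"
    and "\<And>s'. (\<And>i. i < k \<Longrightarrow> fst s' i = m i) \<Longrightarrow> (\<And>i. i < e \<Longrightarrow> snd s' i = snd s i) \<Longrightarrow>
      snd s' e = snd s e * f T \<beta> \<gamma> m \<Longrightarrow> Q s'"
  shows "runs T [cos \<beta>, sin \<beta>, cos \<gamma>, sin \<gamma>] c s b Q"
  by (rule runs_weaken[OF assms(1)[unfolded scales_def, rule_format, OF assms(2)]]) (use assms(3,4) in auto)

lemma runs_Seq_assigns:
  assumes "assigns k d f c b" "\<And>i. i < k \<Longrightarrow> fst s i = m i" "b + b' \<le> b''"
    and "\<And>s'. (\<And>i. i < d \<Longrightarrow> fst s' i = fst s i) \<Longrightarrow> snd s' = snd s \<Longrightarrow> fst s' d = f T m \<Longrightarrow>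
      runs T ps c' s' b' Q"
  shows "runs T ps (Seq c c') s b'' Q"
proof (rule runs_Seq[OF _ _ assms(3)])
  show "runs T ps c s b (\<lambda>s'. runs T ps c' s' b' Q)"
    by (rule runs_assigns[OF assms(1,2)], assumption, rule assms(4))
qed

lemma runs_Seq_scales:
  assumes "scales k e f c p" "\<And>i. i < k \<Longrightarrow> fst s i = m i" "poly p (table_entry T 0 0) + b' \<le> b''"
    and "\<And>s'. (\<And>i. i < k \<Longrightarrow> fst s' i = m i) \<Longrightarrow> (\<And>i. i < e \<Longrightarrow> snd s' i = snd s i) \<Longrightarrow>
      snd s' e = snd s e * f T \<beta> \<gamma> m \<Longrightarrow> runs T [cos \<beta>, sin \<beta>, cos \<gamma>, sin \<gamma>] c' s' b' Q"
  shows "runs T [cos \<beta>, sin \<beta>, cos \<gamma>, sin \<gamma>] (Seq c c') s b'' Q"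
proof (rule runs_Seq[OF _ _ assms(3)])
  show "runs T [cos \<beta>, sin \<beta>, cos \<gamma>, sin \<gamma>] c s (poly p (table_entry T 0 0))
      (\<lambda>s'. runs T [cos \<beta>, sin \<beta>, cos \<gamma>, sin \<gamma>] c' s' b' Q)"
    by (rule runs_scales[OF assms(1,2) order_refl], assumption, rule assms(4))
qed

section \<open>Closure properties of the computable functions\<close>

lemma nat_computable_const: "nat_computable k (\<lambda>T m. n)"
proof -
  have "assigns k d (\<lambda>T m. n) (Instr (NConst d n)) 1" for d
    unfolding assigns_def by (auto intro!: runs_Instr simp: step_eqs)
  then show ?thesis unfolding nat_computable_def by blast
qed

lemma nat_computable_reg:
  assumes "j < k"
  shows "nat_computable k (\<lambda>T m. m j)"
proof -
  have "assigns k d (\<lambda>T m. m j) (Seq (Instr (NConst d 0)) (Instr (NAdd d j d))) 2" if "d \<ge> k" for d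
    unfolding assigns_def
    using assms that by (intro allI impI runs_Seq_Instr[where b = 1] runs_Instr) (auto simp: step_eqs)
  then show ?thesis unfolding nat_computable_def by blast
qed

text \<open>The second operand is computed one register higher, which protects the first
  one.\<close>

lemma nat_computable_binop:
  assumes f: "nat_computable k f" and g: "nat_computable k g"
    and I: "\<And>d T ps s. step T ps (I d) s = ((fst s)(d := op T (fst s d) (fst s (Suc d))), snd s)"
  shows "nat_computable k (\<lambda>T m. op T (f T m) (g T m))"
  unfolding nat_computable_def
proof (intro allI impI)
  fix d assume kd: "k \<le> d"
  obtain c b where c: "assigns k d f c b" using f kd unfolding nat_computable_def by blast
  obtain c' b' where c': "assigns k (Suc d) g c' b'" using g le_SucI[OF kd] unfolding nat_computable_def by blast
  have "assigns k d (\<lambda>T m. op T (f T m) (g T m)) (Seq c (Seq c' (Instr (I d)))) (b + (b' + 1))"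
    unfolding assigns_def
  proof (intro allI impI)
    fix T ps and s :: memory and m :: "nat \<Rightarrow> nat"
    assume m: "\<forall>i<k. fst s i = m i"
    show "runs T ps (Seq c (Seq c' (Instr (I d)))) s (b + (b' + 1))
      (\<lambda>s'. (\<forall>i<d. fst s' i = fst s i) \<and> snd s' = snd s \<and> fst s' d = op T (f T m) (g T m))"
      by (rule runs_Seq_assigns[OF c, where m = m], use m in blast, rule order_refl,
          rule runs_Seq_assigns[OF c', where m = m], use m kd in simp, rule order_refl)
         (rule runs_Instr, simp_all add: I)
  qed
  then show "\<exists>c b. assigns k d (\<lambda>T m. op T (f T m) (g T m)) c b" by blast
qed

lemma nat_computable_add:
  "nat_computable k f \<Longrightarrow> nat_computable k g \<Longrightarrow> nat_computable k (\<lambda>T m. f T m + g T m)"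
  by (erule nat_computable_binop[where op = "\<lambda>T. (+)" and I = "\<lambda>d. NAdd d d (Suc d)"])
     (simp_all add: step_eqs)

lemma nat_computable_diff:
  "nat_computable k f \<Longrightarrow> nat_computable k g \<Longrightarrow> nat_computable k (\<lambda>T m. f T m - g T m)"
  by (erule nat_computable_binop[where op = "\<lambda>T. (-)" and I = "\<lambda>d. NSub d d (Suc d)"])
     (simp_all add: step_eqs)

lemma nat_computable_table_entry:
  "nat_computable k f \<Longrightarrow> nat_computable k g \<Longrightarrow> nat_computable k (\<lambda>T m. table_entry T (f T m) (g T m))"
  by (erule nat_computable_binop[where op = table_entry and I = "\<lambda>d. NRead d d (Suc d)"])
     (simp_all add: step_eqs)

lemma real_computable_of_rat: "real_computable k (\<lambda>T \<beta> \<gamma> m. of_rat q)"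
proof -
  have "scales k e (\<lambda>T \<beta> \<gamma> m. of_rat q) (Instr (RScale e q)) [:1:]" for e
    unfolding scales_def by (auto intro!: runs_Instr simp: step_eqs)
  then show ?thesis unfolding real_computable_def by blast
qed

lemma real_computable_param:
  "real_computable k (\<lambda>T \<beta> \<gamma> m. if l < 4 then [cos \<beta>, sin \<beta>, cos \<gamma>, sin \<gamma>] ! l else 0)"
proof -
  have "scales k e (\<lambda>T \<beta> \<gamma> m. if l < 4 then [cos \<beta>, sin \<beta>, cos \<gamma>, sin \<gamma>] ! l else 0) (Instr (RMul e l)) [:1:]" for e
    unfolding scales_def by (intro allI impI runs_Instr) (simp_all add: step_eqs)
  then show ?thesis unfolding real_computable_def by blast
qed

lemma real_computable_angles:
  "real_computable k (\<lambda>T \<beta> \<gamma> m. cos \<beta>)" "real_computable k (\<lambda>T \<beta> \<gamma> m. sin \<beta>)"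
  "real_computable k (\<lambda>T \<beta> \<gamma> m. cos \<gamma>)" "real_computable k (\<lambda>T \<beta> \<gamma> m. sin \<gamma>)"
  using real_computable_param[of k 0] real_computable_param[of k 1]
    real_computable_param[of k 2] real_computable_param[of k 3]
  by simp_all

lemma real_computableI:
  assumes "\<And>e. \<exists>c p. scales k e f c p"
  shows "real_computable k f"
  using assms unfolding real_computable_def by blast

lemma scalesI:
  assumes "\<And>T \<beta> \<gamma> s m. (\<And>i. i < k \<Longrightarrow> fst s i = m i) \<Longrightarrow>
     runs T [cos \<beta>, sin \<beta>, cos \<gamma>, sin \<gamma>] c s (poly p (table_entry T 0 0))
       (\<lambda>s'. (\<forall>i<k. fst s' i = m i) \<and> (\<forall>i<e. snd s' i = snd s i) \<and> snd s' e = snd s e * f T \<beta> \<gamma> m)"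
  shows "scales k e f c p"
  unfolding scales_def using assms by blast

lemma real_computable_mult:
  assumes f: "real_computable k f" and g: "real_computable k g"
  shows "real_computable k (\<lambda>T \<beta> \<gamma> m. f T \<beta> \<gamma> m * g T \<beta> \<gamma> m)"
proof (rule real_computableI)
  fix e
  obtain c p where c: "scales k e f c p" using f unfolding real_computable_def by blast
  obtain c' p' where c': "scales k e g c' p'" using g unfolding real_computable_def by blast
  have "scales k e (\<lambda>T \<beta> \<gamma> m. f T \<beta> \<gamma> m * g T \<beta> \<gamma> m) (Seq c c') (p + p')"
  proof (rule scalesI)
    fix T and \<beta> \<gamma> :: real and s :: memory and m :: "nat \<Rightarrow> nat"
    assume m: "\<And>i. i < k \<Longrightarrow> fst s i = m i"
    show "runs T [cos \<beta>, sin \<beta>, cos \<gamma>, sin \<gamma>] (Seq c c') s (poly (p + p') (table_entry T 0 0))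
       (\<lambda>s'. (\<forall>i<k. fst s' i = m i) \<and> (\<forall>i<e. snd s' i = snd s i) \<and> snd s' e = snd s e * (f T \<beta> \<gamma> m * g T \<beta> \<gamma> m))"
      apply (rule runs_Seq_scales[OF c, where m = m and b' = "poly p' (table_entry T 0 0)"])
        apply (simp add: m)
       apply simp
      apply (rule runs_scales[OF c', where m = m])
        apply simp_all
      done
  qed
  then show "\<exists>c p. scales k e (\<lambda>T \<beta> \<gamma> m. f T \<beta> \<gamma> m * g T \<beta> \<gamma> m) c p" by blast
qed

text \<open>By distributivity, two copies of the accumulator are scaled separately and added. The
  second copy is made only after the first program has run, since that program may overwrite higher
  registers.\<close>

lemma real_computable_add:
  assumes f: "real_computable k f" and g: "real_computable k g"
  shows "real_computable k (\<lambda>T \<beta> \<gamma> m. f T \<beta> \<gamma> m + g T \<beta> \<gamma> m)"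
proof (rule real_computableI)
  fix e
  let ?e1 = "Suc e" and ?e2 = "Suc (Suc e)"
  obtain c p where c: "scales k ?e1 f c p" using f unfolding real_computable_def by blast
  obtain c' p' where c': "scales k ?e2 g c' p'" using g unfolding real_computable_def by blast
  let ?c = "Seq (Instr (RConst ?e1 0)) (Seq (Instr (RAdd ?e1 e ?e1)) (Seq c
    (Seq (Instr (RConst ?e2 0)) (Seq (Instr (RAdd ?e2 e ?e2)) (Seq c' (Instr (RAdd e ?e1 ?e2)))))))"
  have "scales k e (\<lambda>T \<beta> \<gamma> m. f T \<beta> \<gamma> m + g T \<beta> \<gamma> m) ?c (p + p' + [:5:])"
  proof (rule scalesI)
    fix T and \<beta> \<gamma> :: real and s :: memory and m :: "nat \<Rightarrow> nat"
    assume m: "\<And>i. i < k \<Longrightarrow> fst s i = m i"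
    let ?N = "table_entry T 0 0"
    show "runs T [cos \<beta>, sin \<beta>, cos \<gamma>, sin \<gamma>] ?c s (poly (p + p' + [:5:]) ?N)
       (\<lambda>s'. (\<forall>i<k. fst s' i = m i) \<and> (\<forall>i<e. snd s' i = snd s i) \<and> snd s' e = snd s e * (f T \<beta> \<gamma> m + g T \<beta> \<gamma> m))"
      apply (rule runs_Seq_Instr[where b = "poly p ?N + (poly p' ?N + 3) + 1"])
       apply (rule runs_Seq_Instr[where b = "poly p ?N + (poly p' ?N + 3)"])
        apply (rule runs_Seq_scales[OF c, where m = m])
          apply (simp add: step_eqs m)
         apply (rule order_refl)
        apply (rule runs_Seq_Instr[where b = "poly p' ?N + 2"])
         apply (rule runs_Seq_Instr[where b = "poly p' ?N + 1"])
          apply (rule runs_Seq_scales[OF c', where m = m])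
            apply (simp add: step_eqs)
           apply (rule order_refl)
          apply (rule runs_Instr)
           apply (simp_all add: step_eqs distrib_left)
      done
  qed
  then show "\<exists>c p. scales k e (\<lambda>T \<beta> \<gamma> m. f T \<beta> \<gamma> m + g T \<beta> \<gamma> m) c p" by blast
qed

lemma real_computable_If:
  assumes a: "nat_computable k a" and f: "real_computable k f" and g: "real_computable k g"
  shows "real_computable k (\<lambda>T \<beta> \<gamma> m. if a T m \<noteq> 0 then f T \<beta> \<gamma> m else g T \<beta> \<gamma> m)"
proof (rule real_computableI)
  fix e
  obtain c b where c: "assigns k k a c b" using a unfolding nat_computable_def by blast
  obtain d p where d: "scales k e f d p" using f unfolding real_computable_def by blast
  obtain d' p' where d': "scales k e g d' p'" using g unfolding real_computable_def by blast
  have "scales k e (\<lambda>T \<beta> \<gamma> m. if a T m \<noteq> 0 then f T \<beta> \<gamma> m else g T \<beta> \<gamma> m) (Seq c (Cond k d d')) ([:b:] + (p + p' + [:1:]))"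
  proof (rule scalesI)
    fix T and \<beta> \<gamma> :: real and s :: memory and m :: "nat \<Rightarrow> nat"
    assume m: "\<And>i. i < k \<Longrightarrow> fst s i = m i"
    let ?N = "table_entry T 0 0"
    show "runs T [cos \<beta>, sin \<beta>, cos \<gamma>, sin \<gamma>] (Seq c (Cond k d d')) s (poly ([:b:] + (p + p' + [:1:])) ?N)
       (\<lambda>s'. (\<forall>i<k. fst s' i = m i) \<and> (\<forall>i<e. snd s' i = snd s i) \<and>
          snd s' e = snd s e * (if a T m \<noteq> 0 then f T \<beta> \<gamma> m else g T \<beta> \<gamma> m))"
      apply (rule runs_Seq_assigns[OF c m, where b' = "poly p ?N + poly p' ?N + 1"])
        apply assumption
       apply simp
      apply (rule runs_Cond[where b = "poly p ?N + poly p' ?N"])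
        apply (rule runs_scales[OF d, where m = m]; simp add: m)
       apply (rule runs_scales[OF d', where m = m]; simp add: m)
      apply simp
      done
  qed
  then show "\<exists>c p. scales k e (\<lambda>T \<beta> \<gamma> m. if a T m \<noteq> 0 then f T \<beta> \<gamma> m else g T \<beta> \<gamma> m) c p" by blast
qed

text \<open>Register \<open>k\<close> stores the value and becomes an additional argument of
  \<open>f\<close>.\<close>

lemma real_computable_let:
  assumes a: "nat_computable k a" and f: "real_computable (Suc k) f"
  shows "real_computable k (\<lambda>T \<beta> \<gamma> m. f T \<beta> \<gamma> (m(k := a T m)))"
proof (rule real_computableI)
  fix e
  obtain c b where c: "assigns k k a c b" using a unfolding nat_computable_def by blast
  obtain d p where d: "scales (Suc k) e f d p" using f unfolding real_computable_def by blast
  have "scales k e (\<lambda>T \<beta> \<gamma> m. f T \<beta> \<gamma> (m(k := a T m))) (Seq c d) ([:b:] + p)"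
  proof (rule scalesI)
    fix T and \<beta> \<gamma> :: real and s :: memory and m :: "nat \<Rightarrow> nat"
    assume m: "\<And>i. i < k \<Longrightarrow> fst s i = m i"
    show "runs T [cos \<beta>, sin \<beta>, cos \<gamma>, sin \<gamma>] (Seq c d) s (poly ([:b:] + p) (table_entry T 0 0))
       (\<lambda>s'. (\<forall>i<k. fst s' i = m i) \<and> (\<forall>i<e. snd s' i = snd s i) \<and> snd s' e = snd s e * f T \<beta> \<gamma> (m(k := a T m)))"
      apply (rule runs_Seq_assigns[OF c m, where b' = "poly p (table_entry T 0 0)"])
        apply assumption
       apply simp
      apply (rule runs_scales[OF d, where m = "m(k := a T m)"])
        apply (simp add: m less_Suc_eq)
        apply auto
      done
  qed
  then show "\<exists>c p. scales k e (\<lambda>T \<beta> \<gamma> m. f T \<beta> \<gamma> (m(k := a T m))) c p" by blast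
qed

text \<open>The accumulator is scaled by one factor after another while register \<open>k\<close>,
  which doubles as the index, counts down.\<close>

lemma real_computable_prod:
  assumes f: "real_computable (Suc k) f"
  shows "real_computable k (\<lambda>T \<beta> \<gamma> m. \<Prod>u<table_entry T 0 0. f T \<beta> \<gamma> (m(k := u)))"
proof (rule real_computableI)
  fix e
  obtain d p where d: "scales (Suc k) e f d p" using f unfolding real_computable_def by blast
  let ?body = "Seq (Instr (NConst (Suc k) 1)) (Seq (Instr (NSub k k (Suc k))) d)"
  \<comment> \<open>Reading the table at (0, 0) loads the number of vertices into the
    counter.\<close>
  let ?c = "Seq (Instr (NConst k 0)) (Seq (Instr (NRead k k k)) (While k ?body))"
  \<comment> \<open>A round costs two counter instructions, the program for \<open>f\<close> and a
    test; the last 3 pays for the two initial instructions and the final test.\<close>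
  let ?p = "[:0, 1:] * (p + [:3:]) + [:3:]"
  have "scales k e (\<lambda>T \<beta> \<gamma> m. \<Prod>u<table_entry T 0 0. f T \<beta> \<gamma> (m(k := u))) ?c ?p"
  proof (rule scalesI)
    fix T and \<beta> \<gamma> :: real and s :: memory and m :: "nat \<Rightarrow> nat"
    let ?N = "table_entry T 0 0" and ?ps = "[cos \<beta>, sin \<beta>, cos \<gamma>, sin \<gamma>]"
    assume m: "\<And>i. i < k \<Longrightarrow> fst s i = m i"
    \<comment> \<open>Invariant: the accumulator times the factors still to come is the desired
      product.\<close>
    define I where "I j s' \<longleftrightarrow> fst s' k = j \<and> (\<forall>i<k. fst s' i = m i) \<and> (\<forall>i<e. snd s' i = snd s i) \<and>
      snd s' e * (\<Prod>u<j. f T \<beta> \<gamma> (m(k := u))) = snd s e * (\<Prod>u<?N. f T \<beta> \<gamma> (m(k := u)))" for j and s' :: memory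
    have body: "runs T ?ps ?body s' (poly p ?N + 2) (I j)" if I: "I (Suc j) s'" for j s'
      apply (rule runs_Seq_Instr[where b = "poly p ?N + 1"])
       apply (rule runs_Seq_Instr[where b = "poly p ?N"])
        apply (rule runs_scales[OF d, where m = "m(k := j)"])
      using I by (auto simp: I_def step_eqs less_Suc_eq mult_ac)
    have loop: "runs T ?ps (While k ?body) s' (?N * (poly p ?N + 3) + 1)
       (\<lambda>s'. (\<forall>i<k. fst s' i = m i) \<and> (\<forall>i<e. snd s' i = snd s i) \<and> snd s' e = snd s e * (\<Prod>u<?N. f T \<beta> \<gamma> (m(k := u))))"
      if "I ?N s'" for s'
    proof -
      have "runs T ?ps (While k ?body) s' (?N * (poly p ?N + 3) + 1) (I 0)"
        by (rule runs_While[where I = I and b = "poly p ?N + 2" and n = ?N]) (use that body in \<open>simp_all add: I_def distrib_left\<close>)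
      then show ?thesis by (simp add: runs_def I_def) blast
    qed
    show "runs T ?ps ?c s (poly ?p ?N)
       (\<lambda>s'. (\<forall>i<k. fst s' i = m i) \<and> (\<forall>i<e. snd s' i = snd s i) \<and> snd s' e = snd s e * (\<Prod>u<?N. f T \<beta> \<gamma> (m(k := u))))"
      by (rule runs_Seq_Instr[OF runs_Seq_Instr[OF loop]])
         (auto simp: I_def step_eqs m)
  qed
  then show "\<exists>c p. scales k e (\<lambda>T \<beta> \<gamma> m. \<Prod>u<table_entry T 0 0. f T \<beta> \<gamma> (m(k := u))) c p" by blast
qed

text \<open>The original accumulator is kept in register \<open>e + 1\<close>; each round scales a
  fresh copy of it in \<open>e + 2\<close> and adds the result to \<open>e\<close>, which was reset
  to 0.\<close>

lemma real_computable_sum: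
  assumes f: "real_computable (Suc k) f"
  shows "real_computable k (\<lambda>T \<beta> \<gamma> m. \<Sum>u<table_entry T 0 0. f T \<beta> \<gamma> (m(k := u)))"
proof (rule real_computableI)
  fix e
  let ?e1 = "Suc e" and ?e2 = "Suc (Suc e)"
  obtain d p where d: "scales (Suc k) ?e2 f d p" using f unfolding real_computable_def by blast
  let ?body = "Seq (Instr (NConst (Suc k) 1)) (Seq (Instr (NSub k k (Suc k)))
     (Seq (Instr (RConst ?e2 0)) (Seq (Instr (RAdd ?e2 ?e1 ?e2)) (Seq d (Instr (RAdd e e ?e2))))))"
  let ?c = "Seq (Instr (RConst ?e1 0)) (Seq (Instr (RAdd ?e1 e ?e1)) (Seq (Instr (RConst e 0))
     (Seq (Instr (NConst k 0)) (Seq (Instr (NRead k k k)) (While k ?body)))))"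
  let ?p = "[:0, 1:] * (p + [:6:]) + [:6:]"
  have "scales k e (\<lambda>T \<beta> \<gamma> m. \<Sum>u<table_entry T 0 0. f T \<beta> \<gamma> (m(k := u))) ?c ?p"
  proof (rule scalesI)
    fix T and \<beta> \<gamma> :: real and s :: memory and m :: "nat \<Rightarrow> nat"
    let ?N = "table_entry T 0 0" and ?ps = "[cos \<beta>, sin \<beta>, cos \<gamma>, sin \<gamma>]"
    assume m: "\<And>i. i < k \<Longrightarrow> fst s i = m i"
    define I where "I j s' \<longleftrightarrow> fst s' k = j \<and> (\<forall>i<k. fst s' i = m i) \<and> (\<forall>i<e. snd s' i = snd s i) \<and>
      snd s' ?e1 = snd s e \<and>
      snd s' e + snd s e * (\<Sum>u<j. f T \<beta> \<gamma> (m(k := u))) = snd s e * (\<Sum>u<?N. f T \<beta> \<gamma> (m(k := u)))" for j and s' :: memory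
    have body: "runs T ?ps ?body s' (poly p ?N + 5) (I j)" if I: "I (Suc j) s'" for j s'
      apply (rule runs_Seq_Instr[where b = "poly p ?N + 4"])
       apply (rule runs_Seq_Instr[where b = "poly p ?N + 3"])
        apply (rule runs_Seq_Instr[where b = "poly p ?N + 2"])
         apply (rule runs_Seq_Instr[where b = "poly p ?N + 1"])
          apply (rule runs_Seq_scales[OF d, where m = "m(k := j)" and b' = 1])
            prefer 3
            apply (rule runs_Instr)
      using I by (auto simp: I_def step_eqs less_Suc_eq distrib_left)
    have loop: "runs T ?ps (While k ?body) s' (?N * (poly p ?N + 6) + 1)
       (\<lambda>s'. (\<forall>i<k. fst s' i = m i) \<and> (\<forall>i<e. snd s' i = snd s i) \<and> snd s' e = snd s e * (\<Sum>u<?N. f T \<beta> \<gamma> (m(k := u))))"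
      if "I ?N s'" for s'
    proof -
      have "runs T ?ps (While k ?body) s' (?N * (poly p ?N + 6) + 1) (I 0)"
        by (rule runs_While[where I = I and b = "poly p ?N + 5" and n = ?N]) (use that body in \<open>simp_all add: I_def distrib_left\<close>)
      then show ?thesis by (simp add: runs_def I_def) blast
    qed
    show "runs T ?ps ?c s (poly ?p ?N)
       (\<lambda>s'. (\<forall>i<k. fst s' i = m i) \<and> (\<forall>i<e. snd s' i = snd s i) \<and> snd s' e = snd s e * (\<Sum>u<?N. f T \<beta> \<gamma> (m(k := u))))"
      by (rule runs_Seq_Instr[OF runs_Seq_Instr[OF runs_Seq_Instr[OF runs_Seq_Instr[OF runs_Seq_Instr[OF loop]]]]])
         (auto simp: I_def step_eqs m)
  qed
  then show "\<exists>c p. scales k e (\<lambda>T \<beta> \<gamma> m. \<Sum>u<table_entry T 0 0. f T \<beta> \<gamma> (m(k := u))) c p" by blast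
qed

text \<open>Row \<open>a\<close> of the adjacency matrix follows the header and the indicator vector of \<open>V0\<close>.\<close>

definition adj :: "nat list list \<Rightarrow> nat \<Rightarrow> nat \<Rightarrow> bool" where
  "adj T a b \<longleftrightarrow> table_entry T (2 + a) b \<noteq> 0"

lemma real_computable_rat:
  "real_computable k (\<lambda>T \<beta> \<gamma> m. 0)" "real_computable k (\<lambda>T \<beta> \<gamma> m. 1)"
  "real_computable k (\<lambda>T \<beta> \<gamma> m. of_int n)" "real_computable k (\<lambda>T \<beta> \<gamma> m. of_int n / 2)"
  "real_computable k (\<lambda>T \<beta> \<gamma> m. of_int n / 4)"
  using real_computable_of_rat[of k 0] real_computable_of_rat[of k 1] real_computable_of_rat[of k "of_int n"]
    real_computable_of_rat[of k "of_int n / 2"] real_computable_of_rat[of k "of_int n / 4"]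
  by (simp_all add: of_rat_divide)

lemma real_computable_sum_list:
  "(\<And>x. x \<in> set xs \<Longrightarrow> real_computable k (f x)) \<Longrightarrow> real_computable k (\<lambda>T \<beta> \<gamma> m. \<Sum>x\<leftarrow>xs. f x T \<beta> \<gamma> m)"
  by (induction xs) (auto intro: real_computable_rat real_computable_add)

lemma real_computable_prod_list:
  "(\<And>x. x \<in> set xs \<Longrightarrow> real_computable k (f x)) \<Longrightarrow> real_computable k (\<lambda>T \<beta> \<gamma> m. \<Prod>x\<leftarrow>xs. f x T \<beta> \<gamma> m)"
  by (induction xs) (auto intro: real_computable_rat real_computable_mult)

lemma real_computable_label_weight: "real_computable k (\<lambda>T \<beta> \<gamma> m. label_weight \<beta> l)"
  using real_computable_mult[OF real_computable_rat(4)[of k "- l"] real_computable_angles(2)]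
  by (cases "l = 0") (simp_all add: label_weight_def real_computable_angles)

text \<open>The addition theorems absorb one label at a time, and cosine and sine need each other in
  the induction. Labels in {0, 1, -1} involve only the given cosine and sine of
  \<open>\<gamma>\<close>. The list is fixed, so the recursion is unrolled into the program.\<close>

lemma real_computable_cos_sin:
  assumes "\<And>a l. (a, l) \<in> set xs \<Longrightarrow> nat_computable k a \<and> l \<in> {0, 1, -1}"
  shows "real_computable k (\<lambda>T \<beta> \<gamma> m. cos (\<gamma> * of_int (\<Sum>(a, l)\<leftarrow>xs. if a T m \<noteq> 0 then l else 0)))
    \<and> real_computable k (\<lambda>T \<beta> \<gamma> m. sin (\<gamma> * of_int (\<Sum>(a, l)\<leftarrow>xs. if a T m \<noteq> 0 then l else 0)))"
  using assms
proof (induction xs)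
  case Nil
  then show ?case by (simp add: real_computable_rat)
next
  case (Cons x xs)
  obtain a l where x: "x = (a, l)" by force
  have a: "nat_computable k a" and l: "l \<in> {0, 1, -1}" using Cons.prems x by auto
  let ?M = "\<lambda>T m. \<Sum>(a, l)\<leftarrow>xs. if a T m \<noteq> 0 then l else 0"
  let ?c = "\<lambda>T (\<beta>::real) (\<gamma>::real) m. cos (\<gamma> * of_int (?M T m))"
  let ?s = "\<lambda>T (\<beta>::real) (\<gamma>::real) m. sin (\<gamma> * of_int (?M T m))"
  have "real_computable k ?c \<and> real_computable k ?s" using Cons.prems by (intro Cons.IH) auto
  then have c: "real_computable k ?c" and s: "real_computable k ?s" by blast+
  have cl: "real_computable k (\<lambda>T \<beta> \<gamma> m. cos (\<gamma> * of_int l))"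
    using l by (auto simp: real_computable_rat real_computable_angles)
  have sl: "real_computable k (\<lambda>T \<beta> \<gamma> m. sin (\<gamma> * of_int l))"
    and sl': "real_computable k (\<lambda>T \<beta> \<gamma> m. - sin (\<gamma> * of_int l))"
    using l real_computable_mult[OF real_computable_rat(3)[of k "-1"] real_computable_angles(4)[of k]]
    by (auto simp: real_computable_rat real_computable_angles)
  have "real_computable k (\<lambda>T \<beta> \<gamma> m. if a T m \<noteq> 0
      then cos (\<gamma> * of_int l) * ?c T \<beta> \<gamma> m + - sin (\<gamma> * of_int l) * ?s T \<beta> \<gamma> m else ?c T \<beta> \<gamma> m)"
    by (intro real_computable_If a real_computable_add real_computable_mult cl sl' c s)
  moreover have "(\<lambda>T \<beta> \<gamma> m. cos (\<gamma> * of_int (\<Sum>(a, l)\<leftarrow>x # xs. if a T m \<noteq> 0 then l else 0)))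
    = (\<lambda>T (\<beta>::real) (\<gamma>::real) m. if a T m \<noteq> 0
      then cos (\<gamma> * of_int l) * ?c T \<beta> \<gamma> m + - sin (\<gamma> * of_int l) * ?s T \<beta> \<gamma> m else ?c T \<beta> \<gamma> m)"
    by (intro ext) (simp add: x distrib_left cos_add)
  moreover have "real_computable k (\<lambda>T \<beta> \<gamma> m. if a T m \<noteq> 0
      then sin (\<gamma> * of_int l) * ?c T \<beta> \<gamma> m + cos (\<gamma> * of_int l) * ?s T \<beta> \<gamma> m else ?s T \<beta> \<gamma> m)"
    by (intro real_computable_If a real_computable_add real_computable_mult cl sl c s)
  moreover have "(\<lambda>T \<beta> \<gamma> m. sin (\<gamma> * of_int (\<Sum>(a, l)\<leftarrow>x # xs. if a T m \<noteq> 0 then l else 0)))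
    = (\<lambda>T (\<beta>::real) (\<gamma>::real) m. if a T m \<noteq> 0
      then sin (\<gamma> * of_int l) * ?c T \<beta> \<gamma> m + cos (\<gamma> * of_int l) * ?s T \<beta> \<gamma> m else ?s T \<beta> \<gamma> m)"
    by (intro ext) (simp add: x distrib_left sin_add)
  ultimately show ?case by (simp only: simp_thms)
qed

lemma real_computable_If_eq:
  assumes ij: "i < k" "j < k" and f: "real_computable k f" and g: "real_computable k g"
  shows "real_computable k (\<lambda>T \<beta> \<gamma> m. if m i = m j then f T \<beta> \<gamma> m else g T \<beta> \<gamma> m)"
proof -
  \<comment> \<open>With truncated subtraction, the sum of both differences vanishes exactly at
    equality.\<close>
  have "real_computable k (\<lambda>T \<beta> \<gamma> m. if (m i - m j) + (m j - m i) \<noteq> 0 then g T \<beta> \<gamma> m else f T \<beta> \<gamma> m)"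
    by (intro real_computable_If nat_computable_add nat_computable_diff nat_computable_reg ij f g)
  moreover have "(\<lambda>T \<beta> \<gamma> m. if m i = m j then f T \<beta> \<gamma> m else g T \<beta> \<gamma> m)
    = (\<lambda>T \<beta> \<gamma> m. if (m i - m j) + (m j - m i) \<noteq> 0 then g T \<beta> \<gamma> m else f T \<beta> \<gamma> m)"
    by (intro ext) auto
  ultimately show ?thesis by (simp only:)
qed

lemma nat_computable_adj:
  "i < k \<Longrightarrow> j < k \<Longrightarrow> nat_computable k (\<lambda>T m. table_entry T (2 + m i) (m j))"
  by (intro nat_computable_table_entry nat_computable_add nat_computable_const nat_computable_reg)

lemma real_computable_If_adj:
  assumes ij: "i < k" "j < k" and f: "real_computable k f" and g: "real_computable k g"
  shows "real_computable k (\<lambda>T \<beta> \<gamma> m. if adj T (m i) (m j) then f T \<beta> \<gamma> m else g T \<beta> \<gamma> m)"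
  unfolding adj_def by (intro real_computable_If nat_computable_adj ij f g)

lemma real_computable_vertex_factor:
  assumes "\<And>j l. (j, l) \<in> set xs \<Longrightarrow> j < k \<and> l \<in> {0, 1, -1}" and u: "u < k"
  shows "real_computable k (\<lambda>T \<beta> \<gamma> m. vertex_factor (adj T) \<gamma> (map (\<lambda>(j, l). (m j, l)) xs) (m u))"
proof -
  let ?M = "\<lambda>T m. angle (adj T) (map (\<lambda>(j, l). (m j, l)) xs) (m u)"
  have M: "?M T m = (\<Sum>(a, l)\<leftarrow>map (\<lambda>(j, l). (\<lambda>T m. table_entry T (2 + m u) (m j), l)) xs. if a T m \<noteq> 0 then l else 0)" for T m
    by (induction xs) (auto simp: angle_def adj_def)
  have cs: "real_computable k (\<lambda>T \<beta> \<gamma> m. cos (\<gamma> * ?M T m)) \<and> real_computable k (\<lambda>T \<beta> \<gamma> m. sin (\<gamma> * ?M T m))"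
    unfolding M
  proof (rule real_computable_cos_sin)
    fix a l assume "(a, l) \<in> set (map (\<lambda>(j, l). (\<lambda>T m. table_entry T (2 + m u) (m j), l)) xs)"
    then obtain j where "(j, l) \<in> set xs" "a = (\<lambda>T m. table_entry T (2 + m u) (m j))" by auto
    then show "nat_computable k a \<and> l \<in> {0, 1, -1}"
      using assms(1)[of j l] u nat_computable_adj by auto
  qed
  \<comment> \<open>Only the list in the lookup is generalised; the angle keeps referring to the
    full list \<open>xs\<close>.\<close>
  have "real_computable k (\<lambda>T \<beta> \<gamma> m. case map_of (map (\<lambda>(j, l). (m j, l)) ys) (m u) of
      None \<Rightarrow> cos (\<gamma> * ?M T m) | Some l \<Rightarrow> if l = 0 then sin (\<gamma> * ?M T m) else 1)" if "set ys \<subseteq> set xs" for ys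
    using that
  proof (induction ys)
    case Nil
    then show ?case using cs by simp
  next
    case (Cons y ys)
    obtain j l where y: "y = (j, l)" by force
    have "j < k" using assms(1)[of j l] Cons.prems y by auto
    have "real_computable k (\<lambda>T \<beta> \<gamma> m. if l = 0 then sin (\<gamma> * ?M T m) else 1)"
      using cs by (cases "l = 0") (simp_all add: real_computable_rat)
    then have step: "real_computable k (\<lambda>T \<beta> \<gamma> m. if m u = m j then (if l = 0 then sin (\<gamma> * ?M T m) else 1) else
       (case map_of (map (\<lambda>(j, l). (m j, l)) ys) (m u) of
      None \<Rightarrow> cos (\<gamma> * ?M T m) | Some l \<Rightarrow> if l = 0 then sin (\<gamma> * ?M T m) else 1))"
      using Cons by (intro real_computable_If_eq u \<open>j < k\<close>) auto
    have eq: "(\<lambda>T (\<beta>::real) (\<gamma>::real) m. case map_of (map (\<lambda>(j, l). (m j, l)) (y # ys)) (m u) of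
      None \<Rightarrow> cos (\<gamma> * ?M T m) | Some l \<Rightarrow> if l = 0 then sin (\<gamma> * ?M T m) else 1)
      = (\<lambda>T (\<beta>::real) (\<gamma>::real) m. if m u = m j then (if l = 0 then sin (\<gamma> * ?M T m) else 1) else
       (case map_of (map (\<lambda>(j, l). (m j, l)) ys) (m u) of
      None \<Rightarrow> cos (\<gamma> * ?M T m) | Some l \<Rightarrow> if l = 0 then sin (\<gamma> * ?M T m) else 1))"
      by (intro ext) (simp add: y)
    show ?case unfolding eq by (rule step)
  qed
  then show ?thesis unfolding vertex_factor_def by blast
qed

lemma set_labellings: "set (labellings n) = {ls. length ls = n \<and> set ls \<subseteq> {0, 1, -1}}"
  by (auto simp: labellings_def set_n_lists)

text \<open>The labellings depend only on the number of vertices in \<open>js\<close>, so their sum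
  is unrolled into the program; only the product over all vertices needs a loop.\<close>

lemma real_computable_label_sum:
  assumes js: "\<And>j. j \<in> set js \<Longrightarrow> j < k"
  shows "real_computable k (\<lambda>T \<beta> \<gamma> m. label_sum (adj T) {..<table_entry T 0 0} \<beta> \<gamma> (map m js))"
  unfolding label_sum_def length_map
proof (intro real_computable_sum_list real_computable_mult real_computable_prod_list real_computable_label_weight)
  fix ls assume ls: "ls \<in> set (labellings (length js))"
  let ?f = "\<lambda>T (\<beta>::real) (\<gamma>::real) m. vertex_factor (adj T) \<gamma> (map (\<lambda>(j, l). (m j, l)) (zip js ls)) (m k)"
  have "real_computable (Suc k) ?f"
  proof (rule real_computable_vertex_factor)
    fix j l assume "(j, l) \<in> set (zip js ls)"
    then show "j < Suc k \<and> l \<in> {0, 1, -1}"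
      using js[of j] ls set_zip_leftD[of j l js ls] set_zip_rightD[of j l js ls] by (auto simp: set_labellings)
  qed simp
  then have "real_computable k (\<lambda>T \<beta> \<gamma> m. \<Prod>u<table_entry T 0 0. ?f T \<beta> \<gamma> (m(k := u)))"
    by (rule real_computable_prod)
  \<comment> \<open>The loop register \<open>k\<close> lies above all registers in
    \<open>js\<close>, so its updates leave the labelled vertices unchanged.\<close>
  moreover have "?f T \<beta> \<gamma> (m(k := u)) = vertex_factor (adj T) \<gamma> (zip (map m js) ls) u" for T \<beta> \<gamma> m u
  proof -
    have "map (\<lambda>(j, l). ((m(k := u)) j, l)) (zip js ls) = map (\<lambda>(j, l). (m j, l)) (zip js ls)"
      using js by (intro map_cong refl) (fastforce dest: set_zip_leftD)
    then show ?thesis by (simp only: zip_map1 fun_upd_same)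
  qed
  ultimately show "real_computable k (\<lambda>T \<beta> \<gamma> m. \<Prod>u<table_entry T 0 0. vertex_factor (adj T) \<gamma> (zip (map m js) ls) u)"
    by (simp only:)
qed

text \<open>The three sums cover edges avoiding \<open>v\<close> and \<open>w\<close>, edges at
  \<open>v\<close>, and edges at \<open>w\<close>; in the last two the shared vertex cancels. The
  first sum visits each edge in both orders, hence 1/4, and the signs come from the fourth and
  second powers of \<open>\<i>\<close>.\<close>

definition coupling_value :: "nat list list \<Rightarrow> real \<Rightarrow> real \<Rightarrow> real" where
  "coupling_value T \<beta> \<gamma> = (let N = table_entry T 0 0; v = table_entry T 0 1; w = table_entry T 0 2 in
     - 1 / 4 * (\<Sum>a<N. \<Sum>b<N. if adj T a b \<and> a \<noteq> v \<and> a \<noteq> w \<and> b \<noteq> v \<and> b \<noteq> w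
       then label_sum (adj T) {..<N} \<beta> \<gamma> [a, b, v, w] else 0)
     + 1 / 2 * (\<Sum>b<N. if adj T v b then label_sum (adj T) {..<N} \<beta> \<gamma> [b, w] else 0)
     + 1 / 2 * (\<Sum>b<N. if adj T w b then label_sum (adj T) {..<N} \<beta> \<gamma> [b, v] else 0))"

text \<open>Registers 0 and 1 hold the two vertices, and 2 and 3 are loop indices.\<close>

lemma real_computable_coupling_value: "real_computable 0 (\<lambda>T \<beta> \<gamma> m. coupling_value T \<beta> \<gamma>)"
proof -
  let ?L = "\<lambda>T \<beta> \<gamma> js m. label_sum (adj T) {..<table_entry T 0 0} \<beta> \<gamma> (map m js)"
  let ?F4 = "\<lambda>T \<beta> \<gamma> m. if adj T (m 2) (m 3) then if m 2 = m 0 then 0 else if m 2 = m 1 then 0 else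
     if m 3 = m 0 then 0 else if m 3 = m 1 then 0 else ?L T \<beta> \<gamma> [2, 3, 0, 1] m else 0"
  let ?F2 = "\<lambda>i j T \<beta> \<gamma> m. if adj T (m i) (m 2) then ?L T \<beta> \<gamma> [2, j] m else 0"
  let ?G = "\<lambda>T \<beta> \<gamma> m. of_int (-1) / 4 * (\<Sum>a<table_entry T 0 0. (\<Sum>b<table_entry T 0 0. ?F4 T \<beta> \<gamma> (m(2 := a, 3 := b))))
    + of_int 1 / 2 * (\<Sum>b<table_entry T 0 0. ?F2 0 1 T \<beta> \<gamma> (m(2 := b)))
    + of_int 1 / 2 * (\<Sum>b<table_entry T 0 0. ?F2 1 0 T \<beta> \<gamma> (m(2 := b)))"
  have F4: "real_computable (Suc 3) ?F4"
    by (intro real_computable_If_adj real_computable_If_eq real_computable_label_sum real_computable_rat) auto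
  have F2: "real_computable (Suc 2) (?F2 0 1)" "real_computable (Suc 2) (?F2 1 0)"
    by (intro real_computable_If_adj real_computable_label_sum real_computable_rat; auto)+
  have "Suc 2 = 3" "Suc 1 = 2" by simp_all
  have "real_computable (Suc 2) (\<lambda>T \<beta> \<gamma> m. \<Sum>b<table_entry T 0 0. ?F4 T \<beta> \<gamma> (m(3 := b)))"
    unfolding \<open>Suc 2 = 3\<close> by (rule real_computable_sum[OF F4])
  note S4 = real_computable_sum[OF this]
  note S2 = F2[THEN real_computable_sum]
  have "real_computable 2 ?G"
    by (intro real_computable_add real_computable_mult real_computable_rat S4 S2)
  then have "real_computable (Suc 1) ?G" unfolding \<open>Suc 1 = 2\<close> .
  then have "real_computable (Suc 0) (\<lambda>T \<beta> \<gamma> m. ?G T \<beta> \<gamma> (m(Suc 0 := table_entry T 0 2)))"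
    by (intro real_computable_let[of "Suc 0" "\<lambda>T m. table_entry T 0 2" ?G] nat_computable_table_entry nat_computable_const) simp
  then have "real_computable 0 (\<lambda>T \<beta> \<gamma> m. ?G T \<beta> \<gamma> (m(0 := table_entry T 0 1, Suc 0 := table_entry T 0 2)))"
    by (intro real_computable_let[of 0 "\<lambda>T m. table_entry T 0 1" "\<lambda>T \<beta> \<gamma> m. ?G T \<beta> \<gamma> (m(Suc 0 := table_entry T 0 2))"]
      nat_computable_table_entry nat_computable_const)
  moreover have "?G T \<beta> \<gamma> (m(0 := table_entry T 0 1, Suc 0 := table_entry T 0 2)) = coupling_value T \<beta> \<gamma>" for T \<beta> \<gamma> m
    unfolding coupling_value_def Let_def
    by (intro arg_cong2[of _ _ _ _ "(+)"] arg_cong2[of _ _ _ _ "(*)"] sum.cong refl) auto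
  ultimately show ?thesis by (simp only:)
qed

text \<open>The accumulator is first set to 1, since scaling its initial value 0 would have no
  effect.\<close>

lemma coupling_value_program:
  obtains c p where "\<And>T \<beta> \<gamma>. \<exists>t s. exec T [cos \<beta>, sin \<beta>, cos \<gamma>, sin \<gamma>] c init_memory t s \<and>
    t \<le> poly p (table_entry T 0 0) \<and> snd s 0 = coupling_value T \<beta> \<gamma>"
proof -
  obtain c p where c: "scales 0 0 (\<lambda>T \<beta> \<gamma> m. coupling_value T \<beta> \<gamma>) c p"
    using real_computable_coupling_value unfolding real_computable_def by blast
  have "runs T [cos \<beta>, sin \<beta>, cos \<gamma>, sin \<gamma>] (Seq (Instr (RConst 0 1)) c) init_memory
      (poly (p + [:1:]) (table_entry T 0 0)) (\<lambda>s. snd s 0 = coupling_value T \<beta> \<gamma>)" for T \<beta> \<gamma>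
    by (rule runs_Seq_Instr[OF runs_scales[OF c _ order_refl]]) (simp_all add: step_eqs)
  then show ?thesis using that[of "Seq (Instr (RConst 0 1)) c" "p + [:1:]"] unfolding runs_def by blast
qed

section \<open>Correlators as sums over labellings\<close>

lemma sum_Pow_insert:
  fixes f :: "'a set \<Rightarrow> 'b::comm_monoid_add"
  assumes "finite S" "s \<notin> S"
  shows "(\<Sum>R\<in>Pow (insert s S). f R) = (\<Sum>R\<in>Pow S. f R + f (insert s R))"
proof -
  have "(\<Sum>R\<in>Pow (insert s S). f R) = (\<Sum>R\<in>Pow S. f R) + (\<Sum>R\<in>insert s ` Pow S. f R)"
    unfolding Pow_insert using assms by (intro sum.union_disjoint) auto
  also have "(\<Sum>R\<in>insert s ` Pow S. f R) = (\<Sum>R\<in>Pow S. f (insert s R))"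
    using assms(2) by (intro sum.reindex[unfolded o_def] inj_onI) (auto simp: insert_ident)
  finally show ?thesis by (simp add: sum.distrib)
qed

lemma sum_Pow_prod_if:
  fixes a b :: "'a \<Rightarrow> 'b::comm_ring_1"
  assumes "finite A"
  shows "(\<Sum>w\<in>Pow A. \<Prod>u\<in>A. if u \<in> w then b u else a u) = (\<Prod>u\<in>A. b u + a u)"
  unfolding prod_add[OF assms]
proof (intro sum.cong refl)
  fix w assume "w \<in> Pow A"
  then have "A \<inter> {u. u \<in> w} = w" "A \<inter> - {u. u \<in> w} = A - w" by auto
  then show "(\<Prod>u\<in>A. if u \<in> w then b u else a u) = prod b w * prod a (A - w)"
    using assms by (simp add: prod.If_cases)
qed

lemma sum_Pow_split:
  fixes g :: "'a set \<Rightarrow> 'b::comm_monoid_add"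
  assumes "R \<subseteq> V"
  shows "(\<Sum>x\<in>Pow V. g x) = (\<Sum>y\<in>Pow R. \<Sum>w\<in>Pow (V - R). g (y \<union> w))"
  unfolding sum.cartesian_product
  using assms
  by (intro sum.reindex_bij_witness[of _ "\<lambda>(y, w). y \<union> w" "\<lambda>x. (x \<inter> R, x - R)"])
     (auto intro!: arg_cong[of _ _ g])

definition support :: "('a \<times> int) list \<Rightarrow> 'a set" where
  "support xs = {s. \<exists>l. (s, l) \<in> set xs \<and> l \<noteq> 0}"

definition negatives :: "('a \<times> int) list \<Rightarrow> 'a set" where
  "negatives xs = {s. (s, -1) \<in> set xs}"

text \<open>A pair \<open>y \<subseteq> R \<subseteq> set ss\<close> amounts to three choices per
  vertex: outside \<open>R\<close>, in \<open>R - y\<close>, or in \<open>y\<close>, encoded by 0, 1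
  and -1.\<close>

lemma sum_labellings:
  fixes F :: "'a set \<Rightarrow> 'a set \<Rightarrow> 'b::comm_monoid_add"
  assumes "distinct ss"
  shows "(\<Sum>R\<in>Pow (set ss). \<Sum>y\<in>Pow R. F R y)
    = (\<Sum>ls\<leftarrow>labellings (length ss). F (support (zip ss ls)) (negatives (zip ss ls)))"
  using assms
proof (induction ss arbitrary: F)
  case Nil
  then show ?case by (simp add: labellings_def support_def negatives_def)
next
  case (Cons s ss)
  let ?F = "\<lambda>R y. F R y + (F (insert s R) y + F (insert s R) (insert s y))"
  have fin: "finite R" "s \<notin> R" if "R \<in> Pow (set ss)" for R
    using that Cons.prems finite_subset[of R "set ss"] by auto
  have "(\<Sum>R\<in>Pow (set (s # ss)). \<Sum>y\<in>Pow R. F R y)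
      = (\<Sum>R\<in>Pow (set ss). (\<Sum>y\<in>Pow R. F R y) + (\<Sum>y\<in>Pow (insert s R). F (insert s R) y))"
    using Cons.prems by (simp add: sum_Pow_insert)
  also have "\<dots> = (\<Sum>R\<in>Pow (set ss). \<Sum>y\<in>Pow R. ?F R y)"
    using fin by (intro sum.cong refl) (simp add: sum_Pow_insert sum.distrib)
  also have "\<dots> = (\<Sum>ls\<leftarrow>labellings (length ss). ?F (support (zip ss ls)) (negatives (zip ss ls)))"
    using Cons by simp
  also have "\<dots> = (\<Sum>ls\<leftarrow>labellings (length (s # ss)). F (support (zip (s # ss) ls)) (negatives (zip (s # ss) ls)))"
  proof -
    have "support ((s, l) # xs) = (if l = 0 then support xs else insert s (support xs))" for l xs
      by (auto simp: support_def)
    moreover have "negatives ((s, l) # xs) = (if l = -1 then insert s (negatives xs) else negatives xs)" for l xs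
      by (auto simp: negatives_def)
    moreover have "(\<Sum>ls\<leftarrow>concat (map (\<lambda>ys. [0 # ys, 1 # ys, (-1) # ys]) L). h ls)
      = (\<Sum>ls\<leftarrow>L. h (0 # ls) + (h (1 # ls) + h ((-1) # ls)))" for L and h :: "int list \<Rightarrow> 'b"
      by (induction L) (simp_all add: add.assoc)
    ultimately show ?thesis by (simp add: labellings_def)
  qed
  finally show ?case .
qed

lemma sum_list_zip:
  fixes g :: "'a \<Rightarrow> 'c \<Rightarrow> 'b::comm_monoid_add"
  assumes "length ss = length ls" "distinct ss"
  shows "(\<Sum>(s, l)\<leftarrow>zip ss ls. g s l) = (\<Sum>s\<in>set ss. g s (the (map_of (zip ss ls) s)))"
  using assms by (induction ss ls rule: list_induct2) (auto intro!: sum.cong arg_cong2[of _ _ _ _ "(+)"])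

lemma prod_list_zip:
  fixes g :: "'c \<Rightarrow> 'b::comm_monoid_mult"
  assumes "length ss = length ls" "distinct ss"
  shows "(\<Prod>l\<leftarrow>ls. g l) = (\<Prod>s\<in>set ss. g (the (map_of (zip ss ls) s)))"
  using assms by (induction ss ls rule: list_induct2) (auto intro!: prod.cong arg_cong2[of _ _ _ _ "(*)"])

text \<open>Sum of the Z eigenvalues of the neighbours of \<open>u\<close> in \<open>R\<close>; it
  is the coefficient of \<open>spin u\<close> in the phase of the cut edges.\<close>

definition signed_degree :: "'a set set \<Rightarrow> 'a set \<Rightarrow> 'a set \<Rightarrow> 'a \<Rightarrow> int" where
  "signed_degree E R y u = (\<Sum>r | r \<in> R \<and> {u, r} \<in> E. if r \<in> y then -1 else 1)"

text \<open>Both sides are products over vertices, matched by translating label lookups into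
  membership in \<open>R\<close> and \<open>y\<close>; vertices in \<open>R\<close> have factor 1
  and drop out.\<close>

lemma labelling_term:
  assumes ss: "distinct ss" "set ss \<subseteq> V" and V: "finite V" and ls: "ls \<in> set (labellings (length ss))"
  defines "R \<equiv> support (zip ss ls)" and "y \<equiv> negatives (zip ss ls)"
  shows "(\<Prod>l\<leftarrow>ls. label_weight \<beta> l) * (\<Prod>u\<in>V. vertex_factor (\<lambda>u s. {u, s} \<in> E) \<gamma> (zip ss ls) u)
    = cos \<beta> ^ card (set ss - R) * (- (sin \<beta> / 2)) ^ card R * (\<Prod>r\<in>R. if r \<in> y then -1 else 1) *
      (\<Prod>u\<in>V - R. if u \<in> set ss then sin (\<gamma> * signed_degree E R y u) else cos (\<gamma> * signed_degree E R y u))"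
proof -
  define lab where "lab s = the (map_of (zip ss ls) s)" for s
  have len: "length ss = length ls" and lset: "set ls \<subseteq> {0, 1, -1}" using ls by (auto simp: set_labellings)
  have dist: "distinct (map fst (zip ss ls))" using ss len by simp
  have lab: "map_of (zip ss ls) s = Some (lab s)" "(s, lab s) \<in> set (zip ss ls)" "lab s \<in> {0, 1, -1}" if s: "s \<in> set ss" for s
  proof -
    obtain l where "(s, l) \<in> set (zip ss ls)"
      using s len by (metis in_set_impl_in_set_zip1)
    then have "map_of (zip ss ls) s = Some l" using dist by simp
    then show *: "map_of (zip ss ls) s = Some (lab s)" by (simp add: lab_def)
    then show "(s, lab s) \<in> set (zip ss ls)" by (rule map_of_SomeD)
    then show "lab s \<in> {0, 1, -1}" using lset set_zip_rightD by fastforce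
  qed
  have mem: "s \<in> set ss \<and> l = lab s" if "(s, l) \<in> set (zip ss ls)" for s l
    using that dist by (auto simp: lab_def dest: set_zip_leftD)
  have iff: "(s, l) \<in> set (zip ss ls) \<longleftrightarrow> s \<in> set ss \<and> l = lab s" for s l
    using mem lab(2) by blast
  have R: "R = {s \<in> set ss. lab s \<noteq> 0}" and y: "y = {s \<in> set ss. lab s = -1}"
    by (auto simp: R_def y_def support_def negatives_def iff)
  have RV: "R \<subseteq> V" "finite R" "R \<subseteq> set ss" using R ss by auto
  have sign: "lab r = (if r \<in> y then -1 else 1)" if "r \<in> R" for r
    using that lab(3)[of r] by (auto simp: R y)
  have angle: "angle (\<lambda>u s. {u, s} \<in> E) (zip ss ls) u = signed_degree E R y u" for u
  proof -
    have "angle (\<lambda>u s. {u, s} \<in> E) (zip ss ls) u = (\<Sum>s\<in>set ss. if {u, s} \<in> E then lab s else 0)"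
      unfolding angle_def lab_def by (rule sum_list_zip[OF len ss(1)])
    also have "\<dots> = (\<Sum>r | r \<in> R \<and> {u, r} \<in> E. if r \<in> y then -1 else 1)"
      using sign by (intro sum.mono_neutral_cong_right) (auto simp: R)
    finally show ?thesis by (simp add: signed_degree_def)
  qed
  have "(\<Prod>u\<in>V. vertex_factor (\<lambda>u s. {u, s} \<in> E) \<gamma> (zip ss ls) u)
    = (\<Prod>u\<in>V - R. if u \<in> set ss then sin (\<gamma> * signed_degree E R y u) else cos (\<gamma> * signed_degree E R y u))"
  proof (intro prod.mono_neutral_cong_right ballI)
    fix u assume "u \<in> V - (V - R)"
    then show "vertex_factor (\<lambda>u s. {u, s} \<in> E) \<gamma> (zip ss ls) u = 1"
      using lab(1)[of u] by (auto simp: vertex_factor_def R)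
  next
    fix u assume u: "u \<in> V - R"
    have "map_of (zip ss ls) u = None" if "u \<notin> set ss" using that len by simp
    then show "vertex_factor (\<lambda>u s. {u, s} \<in> E) \<gamma> (zip ss ls) u
      = (if u \<in> set ss then sin (\<gamma> * signed_degree E R y u) else cos (\<gamma> * signed_degree E R y u))"
      using lab(1)[of u] u by (auto simp: vertex_factor_def angle R)
  qed (use V in auto)
  moreover have "(\<Prod>l\<leftarrow>ls. label_weight \<beta> l)
    = cos \<beta> ^ card (set ss - R) * (- (sin \<beta> / 2)) ^ card R * (\<Prod>r\<in>R. if r \<in> y then -1 else 1)"
  proof -
    have "(\<Prod>l\<leftarrow>ls. label_weight \<beta> l) = (\<Prod>s\<in>set ss. label_weight \<beta> (lab s))"
      unfolding lab_def by (rule prod_list_zip[OF len ss(1)])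
    also have "\<dots> = (\<Prod>s\<in>set ss - R. label_weight \<beta> (lab s)) * (\<Prod>s\<in>R. label_weight \<beta> (lab s))"
      using RV by (intro prod.subset_diff) auto
    also have "(\<Prod>s\<in>set ss - R. label_weight \<beta> (lab s)) = (\<Prod>s\<in>set ss - R. cos \<beta>)"
      by (intro prod.cong) (auto simp: label_weight_def R)
    also have "(\<Prod>s\<in>R. label_weight \<beta> (lab s)) = (\<Prod>r\<in>R. - (sin \<beta> / 2) * (if r \<in> y then -1 else 1))"
    proof (intro prod.cong refl)
      fix r assume r: "r \<in> R"
      then have "label_weight \<beta> (lab r) = - (sin \<beta> / 2) * of_int (lab r)" by (simp add: label_weight_def R)
      then show "label_weight \<beta> (lab r) = - (sin \<beta> / 2) * (if r \<in> y then -1 else 1)"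
        by (simp add: sign[OF r])
    qed
    finally show ?thesis unfolding prod.distrib by (simp add: mult.assoc)
  qed
  ultimately show ?thesis by simp
qed

text \<open>Each cut edge is listed once, from its end outside \<open>R\<close> to its end
  inside.\<close>

lemma sum_boundary:
  assumes G: "cubic_graph V E" and R: "R \<subseteq> V"
  shows "(\<Sum>e\<in>boundary E R. f e) = (\<Sum>u\<in>V - R. \<Sum>r | r \<in> R \<and> {u, r} \<in> E. f {u, r})"
proof -
  note G' = cubic_graphD[OF G]
  have fin: "finite {r \<in> R. {u, r} \<in> E}" for u using finite_subset[OF R G'(1)] by auto
  have "(\<Sum>u\<in>V - R. \<Sum>r | r \<in> R \<and> {u, r} \<in> E. f {u, r})
    = (\<Sum>(u, r)\<in>(SIGMA u:V - R. {r \<in> R. {u, r} \<in> E}). f {u, r})"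
    using G'(1) fin by (intro sum.Sigma) auto
  also have "\<dots> = (\<Sum>e\<in>boundary E R. f e)"
  proof -
    have "inj_on (\<lambda>p. {fst p, snd p}) (SIGMA u:V - R. {r \<in> R. {u, r} \<in> E})"
      by (auto simp: inj_on_def doubleton_eq_iff)
    from sum.reindex[OF this, of f]
    have "(\<Sum>(u, r)\<in>(SIGMA u:V - R. {r \<in> R. {u, r} \<in> E}). f {u, r})
      = sum f ((\<lambda>p. {fst p, snd p}) ` (SIGMA u:V - R. {r \<in> R. {u, r} \<in> E}))"
      by (simp add: o_def split_def)
    also have "(\<lambda>p. {fst p, snd p}) ` (SIGMA u:V - R. {r \<in> R. {u, r} \<in> E}) = boundary E R"
    proof (intro equalityI subsetI)
      fix e assume e: "e \<in> boundary E R"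
      then have eE: "e \<in> E" "card (e \<inter> R) = 1" by (auto simp: boundary_def)
      then obtain r where r: "e \<inter> R = {r}" by (auto simp: card_1_singleton_iff)
      then have "r \<in> e" by auto
      then obtain u where u: "e = {r, u}" "u \<noteq> r" "u \<in> V" using cubic_edge_cases[OF G eE(1)] by metis
      then have "u \<notin> R" "r \<in> R" using r by auto
      then show "e \<in> (\<lambda>p. {fst p, snd p}) ` (SIGMA u:V - R. {r \<in> R. {u, r} \<in> E})"
        using u eE by (intro image_eqI[of _ _ "(u, r)"]) (auto simp: insert_commute)
    qed (auto simp: boundary_def Int_insert_left)
    finally show ?thesis .
  qed
  finally show ?thesis by simp
qed

text \<open>Once the part \<open>y\<close> of the state on \<open>R\<close> is fixed, cut edges do
  not couple the remaining qubits to each other. Their sum therefore factorises.\<close>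

lemma boundary_sum_eq:
  assumes G: "cubic_graph V E" and R: "R \<subseteq> S" and S: "S \<subseteq> V"
  shows "(\<Sum>x\<in>Pow V. chi S x * exp (\<i> * of_real \<gamma> * (\<Sum>e\<in>boundary E R. chi e x)))
    = 2 ^ card (V - R) * \<i> ^ card (S - R) * (\<Sum>y\<in>Pow R. of_real ((\<Prod>r\<in>R. if r \<in> y then -1 else 1) *
        (\<Prod>u\<in>V - R. if u \<in> S then sin (\<gamma> * signed_degree E R y u) else cos (\<gamma> * signed_degree E R y u))))"
proof -
  note G' = cubic_graphD[OF G]
  have RV: "R \<subseteq> V" using R S by auto
  have fin: "finite (V - R)" "finite R" "finite S" using G'(1) finite_subset[OF RV] finite_subset[OF S] by auto
  let ?sg = "\<lambda>y. complex_of_real (\<Prod>r\<in>R. if r \<in> y then -1 else 1)"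
  let ?m = "\<lambda>y u. complex_of_real (\<gamma> * signed_degree E R y u)"
  have summand: "chi S (y \<union> w) * exp (\<i> * of_real \<gamma> * (\<Sum>e\<in>boundary E R. chi e (y \<union> w)))
      = ?sg y * (\<Prod>u\<in>V - R. if u \<in> w then (if u \<in> S then -1 else 1) * exp (- (\<i> * ?m y u)) else exp (\<i> * ?m y u))"
    if y: "y \<in> Pow R" and w: "w \<in> Pow (V - R)" for y w
  proof -
    have "chi S (y \<union> w) = chi R (y \<union> w) * chi (S - R) (y \<union> w)"
      unfolding chi_def using R fin by (subst prod.subset_diff[of R S]) (simp_all add: mult.commute)
    also have "chi R (y \<union> w) = ?sg y"
      unfolding chi_def of_real_prod using w by (intro prod.cong refl) (auto simp: spin_def)
    also have "chi (S - R) (y \<union> w) = (\<Prod>u\<in>V - R. if u \<in> S then spin u w else 1)"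
      unfolding chi_def using S fin y by (intro prod.mono_neutral_cong_left) (auto simp: spin_def)
    finally have chi: "chi S (y \<union> w) = ?sg y * (\<Prod>u\<in>V - R. if u \<in> S then spin u w else 1)" .
    have "(\<Sum>e\<in>boundary E R. chi e (y \<union> w)) = (\<Sum>u\<in>V - R. spin u w * of_int (signed_degree E R y u))"
      unfolding sum_boundary[OF G RV] signed_degree_def of_int_sum sum_distrib_left
    proof (intro sum.cong refl)
      fix u r assume u: "u \<in> V - R" and r: "r \<in> {r \<in> R. {u, r} \<in> E}"
      then have "u \<noteq> r" by auto
      then show "chi {u, r} (y \<union> w) = spin u w * of_int (if r \<in> y then - 1 else 1)"
        using u r y w by (auto simp: chi_def spin_def)
    qed
    then have ex: "exp (\<i> * of_real \<gamma> * (\<Sum>e\<in>boundary E R. chi e (y \<union> w))) = (\<Prod>u\<in>V - R. exp (spin u w * (\<i> * ?m y u)))"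
      by (simp add: sum_distrib_left exp_sum[OF fin(1)] mult_ac)
    show ?thesis
      unfolding chi ex mult.assoc[of "?sg y"] prod.distrib[symmetric]
      by (intro arg_cong2[of _ _ _ _ "(*)"] prod.cong refl) (auto simp: spin_def)
  qed
  have euler: "exp (\<i> * of_real t) = of_real (cos t) + \<i> * of_real (sin t)"
    "exp (- (\<i> * of_real t)) = of_real (cos t) - \<i> * of_real (sin t)" for t
    using exp_i_spin[of t undefined "{}"] exp_i_spin[of t undefined UNIV] by (simp_all add: spin_def)
  \<comment> \<open>Summing over one qubit: twice a cosine, or, when \<open>u\<close> is in
    \<open>S\<close> and contributes a further sign, twice \<open>\<i>\<close> times a sine.\<close>
  have pair: "(if u \<in> S then -1 else 1) * exp (- (\<i> * ?m y u)) + exp (\<i> * ?m y u)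
      = 2 * (if u \<in> S then \<i> else 1) * of_real (if u \<in> S then sin (\<gamma> * signed_degree E R y u) else cos (\<gamma> * signed_degree E R y u))" for u y
    unfolding euler by (cases "u \<in> S") simp_all
  have "(\<Sum>x\<in>Pow V. chi S x * exp (\<i> * of_real \<gamma> * (\<Sum>e\<in>boundary E R. chi e x)))
    = (\<Sum>y\<in>Pow R. ?sg y * (\<Sum>w\<in>Pow (V - R). \<Prod>u\<in>V - R. if u \<in> w then (if u \<in> S then -1 else 1) * exp (- (\<i> * ?m y u)) else exp (\<i> * ?m y u)))"
    by (simp only: sum_Pow_split[OF RV] summand sum_distrib_left[of "?sg _"] cong: sum.cong)
  also have "\<dots> = (\<Sum>y\<in>Pow R. ?sg y * (2 ^ card (V - R) * \<i> ^ card (S - R) *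
      of_real (\<Prod>u\<in>V - R. if u \<in> S then sin (\<gamma> * signed_degree E R y u) else cos (\<gamma> * signed_degree E R y u))))"
  proof (intro sum.cong refl arg_cong2[of _ _ _ _ "(*)"])
    fix y
    have "(\<Prod>u\<in>V - R. if u \<in> S then \<i> else 1) = (\<Prod>u\<in>S - R. \<i>)"
      using S fin by (intro prod.mono_neutral_cong_right) auto
    then show "(\<Sum>w\<in>Pow (V - R). \<Prod>u\<in>V - R. if u \<in> w then (if u \<in> S then -1 else 1) * exp (- (\<i> * ?m y u)) else exp (\<i> * ?m y u))
      = 2 ^ card (V - R) * \<i> ^ card (S - R) *
      of_real (\<Prod>u\<in>V - R. if u \<in> S then sin (\<gamma> * signed_degree E R y u) else cos (\<gamma> * signed_degree E R y u))"
      unfolding sum_Pow_prod_if[OF fin(1)] pair prod.distrib of_real_prod by simp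
  qed
  finally show ?thesis by (simp add: sum_distrib_left mult_ac)
qed

text \<open>The factors \<open>\<i>\<close> from \<open>S - R\<close> and \<open>- \<i>\<close> from
  \<open>R\<close> combine to \<open>\<i> ^ length ss\<close> and a sign for each vertex of
  \<open>R\<close>; that sign and the leftover factor 1/2 per vertex of \<open>R\<close> are part of
  \<open>label_weight\<close>.\<close>

lemma corr_label_sum:
  assumes G: "cubic_graph V E" and ss: "distinct ss" "set ss \<subseteq> V"
  shows "corr V E \<beta> \<gamma> (set ss) = \<i> ^ length ss * of_real (label_sum (\<lambda>u s. {u, s} \<in> E) V \<beta> \<gamma> ss)"
proof -
  let ?S = "set ss"
  let ?F = "\<lambda>R y. cos \<beta> ^ card (?S - R) * (- (sin \<beta> / 2)) ^ card R * (\<Prod>r\<in>R. if r \<in> y then -1 else 1) *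
      (\<Prod>u\<in>V - R. if u \<in> ?S then sin (\<gamma> * signed_degree E R y u) else cos (\<gamma> * signed_degree E R y u))"
  have "corr V E \<beta> \<gamma> ?S = (\<Sum>R\<in>Pow ?S. \<Sum>y\<in>Pow R. \<i> ^ length ss * of_real (?F R y))"
    unfolding corr_eq[OF G ss(2)]
  proof (intro sum.cong refl)
    fix R assume "R \<in> Pow ?S"
    then have R: "R \<subseteq> ?S" by simp
    have RV: "R \<subseteq> V" "finite R" using R ss finite_subset[OF R] by auto
    have V: "finite V" by (rule cubic_graphD(1)[OF G])
    have "card ?S = card (?S - R) + card R"
      using R card_mono[OF _ R] by (simp add: card_Diff_subset[OF RV(2) R])
    then have len: "length ss = card (?S - R) + card R" using distinct_card[OF ss(1)] by simp
    have "card V = card (V - R) + card R"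
      using card_mono[OF V RV(1)] by (simp add: card_Diff_subset[OF RV(2,1)])
    then have pow: "(2::complex) ^ card V = 2 ^ card (V - R) * 2 ^ card R" by (simp add: power_add)
    have phase: "(- \<i> * of_real (sin \<beta>)) ^ card R * \<i> ^ card (?S - R) / 2 ^ card R
      = \<i> ^ length ss * of_real ((- (sin \<beta> / 2)) ^ card R)"
    proof -
      have "(- \<i> * of_real (sin \<beta>)) ^ card R * \<i> ^ card (?S - R) / 2 ^ card R
        = \<i> ^ card (?S - R) * ((- \<i> * of_real (sin \<beta>)) ^ card R / 2 ^ card R)" by simp
      also have "(- \<i> * of_real (sin \<beta>)) ^ card R / 2 ^ card R = (\<i> * of_real (- (sin \<beta> / 2))) ^ card R"
        by (simp flip: power_divide)
      finally show ?thesis by (simp only: len power_add power_mult_distrib of_real_power mult_ac)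
    qed
    show "of_real (cos \<beta>) ^ card (?S - R) * (- \<i> * of_real (sin \<beta>)) ^ card R *
      ((\<Sum>x\<in>Pow V. chi ?S x * exp (\<i> * of_real \<gamma> * (\<Sum>e\<in>boundary E R. chi e x))) / 2 ^ card V)
      = (\<Sum>y\<in>Pow R. \<i> ^ length ss * of_real (?F R y))"
    proof -
      let ?P = "\<lambda>y. (\<Prod>r\<in>R. if r \<in> y then -1 else 1) *
        (\<Prod>u\<in>V - R. if u \<in> ?S then sin (\<gamma> * signed_degree E R y u) else cos (\<gamma> * signed_degree E R y u))"
      have "of_real (cos \<beta>) ^ card (?S - R) * (- \<i> * of_real (sin \<beta>)) ^ card R *
        ((\<Sum>x\<in>Pow V. chi ?S x * exp (\<i> * of_real \<gamma> * (\<Sum>e\<in>boundary E R. chi e x))) / 2 ^ card V)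
        = of_real (cos \<beta>) ^ card (?S - R) * ((- \<i> * of_real (sin \<beta>)) ^ card R * \<i> ^ card (?S - R) / 2 ^ card R) *
          (\<Sum>y\<in>Pow R. of_real (?P y))"
        unfolding boundary_sum_eq[OF G R ss(2)] pow by simp
      also have "\<dots> = (\<Sum>y\<in>Pow R. \<i> ^ length ss * of_real (?F R y))"
        unfolding phase sum_distrib_left
        by (intro sum.cong refl) (simp only: of_real_mult of_real_power mult_ac)
      finally show ?thesis .
    qed
  qed
  also have "\<dots> = (\<Sum>ls\<leftarrow>labellings (length ss). \<i> ^ length ss * of_real (?F (support (zip ss ls)) (negatives (zip ss ls))))"
    by (rule sum_labellings[OF ss(1)])
  also have "\<dots> = (\<Sum>ls\<leftarrow>labellings (length ss). \<i> ^ length ss * of_real ((\<Prod>l\<leftarrow>ls. label_weight \<beta> l) *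
      (\<Prod>u\<in>V. vertex_factor (\<lambda>u s. {u, s} \<in> E) \<gamma> (zip ss ls) u)))"
    by (intro arg_cong[of _ _ sum_list] map_cong refl)
       (simp only: labelling_term[OF ss cubic_graphD(1)[OF G]])
  also have "\<dots> = \<i> ^ length ss * of_real (label_sum (\<lambda>u s. {u, s} \<in> E) V \<beta> \<gamma> ss)"
  proof -
    have "(\<Sum>x\<leftarrow>xs. c * complex_of_real (h x)) = c * of_real (\<Sum>x\<leftarrow>xs. h x)" for xs :: "int list list" and h c
      by (induction xs) (simp_all add: distrib_left)
    then show ?thesis by (simp only: label_sum_def)
  qed
  finally show ?thesis .
qed

section \<open>The couplings\<close>

lemma table_entry_encode:
  "table_entry (encode vs E V0 i j) 0 0 = length vs"
  "table_entry (encode vs E V0 i j) 0 1 = i"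
  "table_entry (encode vs E V0 i j) 0 2 = j"
  by (simp_all add: table_entry_def encode_def)

lemma adj_encode:
  "a < length vs \<Longrightarrow> b < length vs \<Longrightarrow> adj (encode vs E V0 i j) a b \<longleftrightarrow> {vs ! a, vs ! b} \<in> E"
  by (simp add: adj_def table_entry_def encode_def)

lemma vertex_factor_map:
  assumes u: "u \<in> B" and xs: "fst ` set xs \<subseteq> B" and f: "inj_on f B"
    and A: "\<And>a b. a \<in> B \<Longrightarrow> b \<in> B \<Longrightarrow> A' (f a) (f b) \<longleftrightarrow> A a b"
  shows "vertex_factor A' \<gamma> (map (\<lambda>(s, l). (f s, l)) xs) (f u) = vertex_factor A \<gamma> xs u"
proof -
  have "map_of (map (\<lambda>(s, l). (f s, l)) xs) (f u) = map_of xs u"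
    using xs by (induction xs) (auto simp: inj_on_eq_iff[OF f] u)
  moreover have "angle A' (map (\<lambda>(s, l). (f s, l)) xs) (f u) = angle A xs u"
    unfolding angle_def using xs u A by (induction xs) auto
  ultimately show ?thesis unfolding vertex_factor_def by (simp only:)
qed

lemma label_sum_map:
  assumes ss: "set ss \<subseteq> B" and f: "inj_on f B"
    and A: "\<And>a b. a \<in> B \<Longrightarrow> b \<in> B \<Longrightarrow> A' (f a) (f b) \<longleftrightarrow> A a b"
  shows "label_sum A' (f ` B) \<beta> \<gamma> (map f ss) = label_sum A B \<beta> \<gamma> ss"
proof -
  have "(\<Prod>u\<in>f ` B. vertex_factor A' \<gamma> (zip (map f ss) ls) u) = (\<Prod>u\<in>B. vertex_factor A \<gamma> (zip ss ls) u)" for ls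
  proof -
    have xs: "fst ` set (zip ss ls) \<subseteq> B" using ss by (auto dest: set_zip_leftD)
    have "vertex_factor A' \<gamma> (zip (map f ss) ls) (f u) = vertex_factor A \<gamma> (zip ss ls) u" if "u \<in> B" for u
      unfolding zip_map1 by (rule vertex_factor_map[where A = A, OF that xs f]) (rule A)
    then show ?thesis by (simp add: prod.reindex[OF f])
  qed
  then show ?thesis by (simp add: label_sum_def)
qed

lemma label_sum_encode:
  assumes "distinct vs" "set js \<subseteq> {..<length vs}"
  shows "label_sum (adj (encode vs E V0 i j)) {..<length vs} \<beta> \<gamma> js
    = label_sum (\<lambda>u s. {u, s} \<in> E) (set vs) \<beta> \<gamma> (map ((!) vs) js)"
proof -
  have "inj_on ((!) vs) {..<length vs}" using assms(1) by (simp add: inj_on_nth)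
  from label_sum_map[OF assms(2) this, of "\<lambda>u s. {u, s} \<in> E" "adj (encode vs E V0 i j)" \<beta> \<gamma>]
  moreover have "(!) vs ` {..<length vs} = set vs" by (auto simp: set_conv_nth)
  ultimately show ?thesis by (simp add: adj_encode)
qed

lemma sum_incident_edges:
  assumes G: "cubic_graph V E" and v: "v \<in> V"
  shows "(\<Sum>e | e \<in> E \<and> v \<in> e. f e) = (\<Sum>b\<in>V. if {v, b} \<in> E then f {v, b} else 0)"
proof -
  have "(\<Sum>b\<in>V. if {v, b} \<in> E then f {v, b} else 0) = (\<Sum>b\<in>{b \<in> V. {v, b} \<in> E}. f {v, b})"
    using cubic_graphD(1)[OF G] by (simp add: sum.inter_filter)
  also have "\<dots> = (\<Sum>e\<in>(\<lambda>b. {v, b}) ` {b \<in> V. {v, b} \<in> E}. f e)"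
    by (subst sum.reindex) (auto simp: inj_on_def doubleton_eq_iff)
  also have "(\<lambda>b. {v, b}) ` {b \<in> V. {v, b} \<in> E} = {e \<in> E. v \<in> e}"
    using cubic_edge_cases[OF G] by blast
  finally show ?thesis by simp
qed

text \<open>Each edge is met once from each of its two ends.\<close>

lemma sum_ordered_edges:
  fixes f :: "'a set \<Rightarrow> real"
  assumes G: "cubic_graph V E"
  shows "(\<Sum>a\<in>V. \<Sum>b\<in>V. if {a, b} \<in> E then f {a, b} else 0) = 2 * (\<Sum>e\<in>E. f e)"
proof -
  note G' = cubic_graphD[OF G]
  have "(\<Sum>a\<in>V. \<Sum>b\<in>V. if {a, b} \<in> E then f {a, b} else 0) = (\<Sum>a\<in>V. \<Sum>e | e \<in> E \<and> a \<in> e. f e)"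
    by (simp add: sum_incident_edges[OF G])
  also have "\<dots> = (\<Sum>e\<in>E. \<Sum>a | a \<in> V \<and> a \<in> e. f e)"
    by (rule sum.swap_restrict[OF G'(1,2)])
  also have "\<dots> = (\<Sum>e\<in>E. 2 * f e)"
  proof (intro sum.cong refl)
    fix e assume e: "e \<in> E"
    then have "{a. a \<in> V \<and> a \<in> e} = e" using G'(3) by blast
    then show "(\<Sum>a | a \<in> V \<and> a \<in> e. f e) = 2 * f e" using G'(4)[OF e] by simp
  qed
  finally show ?thesis by (simp add: sum_distrib_left)
qed

lemma Re_corr:
  assumes "cubic_graph V E"
  shows "distinct [a, b] \<Longrightarrow> {a, b} \<subseteq> V \<Longrightarrow>
      Re (corr V E \<beta> \<gamma> {a, b}) = - label_sum (\<lambda>u s. {u, s} \<in> E) V \<beta> \<gamma> [a, b]"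
    and "distinct [a, b, v, w] \<Longrightarrow> {a, b, v, w} \<subseteq> V \<Longrightarrow>
      Re (corr V E \<beta> \<gamma> {a, b, v, w}) = label_sum (\<lambda>u s. {u, s} \<in> E) V \<beta> \<gamma> [a, b, v, w]"
  using corr_label_sum[OF assms, of "[a, b]" \<beta> \<gamma>] corr_label_sum[OF assms, of "[a, b, v, w]" \<beta> \<gamma>]
  by (simp_all add: eval_nat_numeral)

text \<open>The edges are partitioned according to whether they contain \<open>v\<close>,
  \<open>w\<close> or neither; no edge contains both, by 2-independence.\<close>

lemma coupling_eq_label_sums:
  fixes \<beta> \<gamma> :: real
  assumes G: "cubic_graph V E" and I: "two_independent V E V0"
    and vw: "v \<in> V0" "w \<in> V0" "v \<noteq> w"
  defines "L \<equiv> label_sum (\<lambda>u s. {u, s} \<in> E) V \<beta> \<gamma>"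
  shows "coupling V E V0 \<beta> \<gamma> {v, w} =
    - 1 / 4 * (\<Sum>a\<in>V. \<Sum>b\<in>V. if {a, b} \<in> E \<and> a \<noteq> v \<and> a \<noteq> w \<and> b \<noteq> v \<and> b \<noteq> w then L [a, b, v, w] else 0)
    + 1 / 2 * (\<Sum>b\<in>V. if {v, b} \<in> E then L [b, w] else 0)
    + 1 / 2 * (\<Sum>b\<in>V. if {w, b} \<in> E then L [b, v] else 0)"
proof -
  note G' = cubic_graphD[OF G]
  define f where "f e = Re (corr V E \<beta> \<gamma> (sym_diff e {v, w}))" for e
  have V: "v \<in> V" "w \<in> V" using vw I by (auto simp: two_independent_def)
  have not_adj: "{v, w} \<notin> E" using two_independentD(1)[OF I, of v w] vw by auto
  have loop: "a \<noteq> b" if "{a, b} \<in> E" for a b using G'(4)[OF that] by auto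
  \<comment> \<open>Stated for \<open>p\<close> and \<open>q\<close> so that it can be used with
    both orders of \<open>v\<close> and \<open>w\<close>.\<close>
  have incident: "(\<Sum>e | e \<in> E \<and> p \<in> e. f e) = - (\<Sum>b\<in>V. if {p, b} \<in> E then L [b, q] else 0)"
    if pq: "{p, q} = {v, w}" for p q
  proof -
    have p: "p \<in> V" "q \<in> V" "p \<noteq> q" "{p, q} \<notin> E" using pq V vw not_adj by (auto simp: doubleton_eq_iff insert_commute)
    have "f {p, b} = - L [b, q]" if "b \<in> V" "{p, b} \<in> E" for b
    proof -
      have "b \<noteq> p" "b \<noteq> q" using loop[OF that(2)] p that by auto
      then have "sym_diff {p, b} {p, q} = {b, q}" using p by auto
      then show ?thesis
        unfolding f_def pq[symmetric] L_def using Re_corr(1)[OF G, of b q \<beta> \<gamma>] \<open>b \<noteq> q\<close> that p by simp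
    qed
    then show ?thesis unfolding sum_incident_edges[OF G p(1)] sum_negf[symmetric] by (intro sum.cong refl) simp
  qed
  have far: "2 * (\<Sum>e | e \<in> E \<and> v \<notin> e \<and> w \<notin> e. f e)
    = (\<Sum>a\<in>V. \<Sum>b\<in>V. if {a, b} \<in> E \<and> a \<noteq> v \<and> a \<noteq> w \<and> b \<noteq> v \<and> b \<noteq> w then L [a, b, v, w] else 0)"
  proof -
    have "2 * (\<Sum>e | e \<in> E \<and> v \<notin> e \<and> w \<notin> e. f e) = 2 * (\<Sum>e\<in>E. if v \<notin> e \<and> w \<notin> e then f e else 0)"
      using G'(2) by (simp add: sum.inter_filter)
    also have "\<dots> = (\<Sum>a\<in>V. \<Sum>b\<in>V. if {a, b} \<in> E then if v \<notin> {a, b} \<and> w \<notin> {a, b} then f {a, b} else 0 else 0)"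
      by (rule sum_ordered_edges[OF G, symmetric])
    also have "\<dots> = (\<Sum>a\<in>V. \<Sum>b\<in>V. if {a, b} \<in> E \<and> a \<noteq> v \<and> a \<noteq> w \<and> b \<noteq> v \<and> b \<noteq> w then L [a, b, v, w] else 0)"
    proof (intro sum.cong refl)
      fix a b assume ab: "a \<in> V" "b \<in> V"
      have "f {a, b} = L [a, b, v, w]" if "{a, b} \<in> E" "v \<notin> {a, b}" "w \<notin> {a, b}"
      proof -
        have "sym_diff {a, b} {v, w} = {a, b, v, w}" using that by auto
        then show ?thesis
          unfolding f_def L_def using Re_corr(2)[OF G, of a b v w \<beta> \<gamma>] loop[OF that(1)] that ab V vw by auto
      qed
      then show "(if {a, b} \<in> E then if v \<notin> {a, b} \<and> w \<notin> {a, b} then f {a, b} else 0 else 0)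
        = (if {a, b} \<in> E \<and> a \<noteq> v \<and> a \<noteq> w \<and> b \<noteq> v \<and> b \<noteq> w then L [a, b, v, w] else 0)" by auto
    qed
    finally show ?thesis .
  qed
  have disjoint: "{e \<in> E. v \<in> e} \<inter> {e \<in> E. w \<in> e} = {}"
  proof -
    have False if e: "e \<in> E" "v \<in> e" "w \<in> e" for e
    proof -
      obtain b where "e = {v, b}" using cubic_edge_cases[OF G e(1,2)] by metis
      then have "e = {v, w}" using e vw(3) by auto
      then show False using e not_adj by simp
    qed
    then show ?thesis by blast
  qed
  have "E = {e \<in> E. v \<notin> e \<and> w \<notin> e} \<union> ({e \<in> E. v \<in> e} \<union> {e \<in> E. w \<in> e})" by auto
  then have "(\<Sum>e\<in>E. f e) = (\<Sum>e\<in>{e \<in> E. v \<notin> e \<and> w \<notin> e} \<union> ({e \<in> E. v \<in> e} \<union> {e \<in> E. w \<in> e}). f e)"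
    by (rule arg_cong)
  also have "\<dots> = (\<Sum>e | e \<in> E \<and> v \<notin> e \<and> w \<notin> e. f e) + (\<Sum>e\<in>{e \<in> E. v \<in> e} \<union> {e \<in> E. w \<in> e}. f e)"
    using G'(2) by (intro sum.union_disjoint) auto
  also have "(\<Sum>e\<in>{e \<in> E. v \<in> e} \<union> {e \<in> E. w \<in> e}. f e) = (\<Sum>e | e \<in> E \<and> v \<in> e. f e) + (\<Sum>e | e \<in> E \<and> w \<in> e. f e)"
    using G'(2) disjoint by (intro sum.union_disjoint) auto
  finally have "(\<Sum>e\<in>E. f e) = (\<Sum>e | e \<in> E \<and> v \<notin> e \<and> w \<notin> e. f e) +
      ((\<Sum>e | e \<in> E \<and> v \<in> e. f e) + (\<Sum>e | e \<in> E \<and> w \<in> e. f e))" .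
  moreover have "coupling V E V0 \<beta> \<gamma> {v, w} = - (1 / 2) * (\<Sum>e\<in>E. f e)"
    by (simp only: coupling_def f_def)
  ultimately show ?thesis
    using far incident[OF refl] incident[of w v, OF insert_commute] by linarith
qed

lemma coupling_eq_coupling_value:
  assumes G: "cubic_graph V E" and I: "two_independent V E V0" and vs: "distinct vs" "set vs = V"
    and ij: "i < length vs" "j < length vs" "i \<noteq> j" "vs ! i \<in> V0" "vs ! j \<in> V0"
  shows "coupling V E V0 \<beta> \<gamma> {vs ! i, vs ! j} = coupling_value (encode vs E V0 i j) \<beta> \<gamma>"
proof -
  let ?T = "encode vs E V0 i j"
  have V: "(\<Sum>u\<in>V. h u) = (\<Sum>a<length vs. h (vs ! a))" for h :: "'a \<Rightarrow> real"
    by (rule sum.reindex_bij_betw[OF bij_betw_nth[OF vs(1) refl vs(2)[symmetric]], symmetric])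
  have ne: "vs ! i \<noteq> vs ! j" using ij vs(1) by (simp add: nth_eq_iff_index_eq)
  have L: "label_sum (adj ?T) {..<length vs} \<beta> \<gamma> js = label_sum (\<lambda>u s. {u, s} \<in> E) V \<beta> \<gamma> (map ((!) vs) js)"
    if "set js \<subseteq> {..<length vs}" for js
    using label_sum_encode[OF vs(1) that] vs(2) by simp
  show ?thesis
    unfolding coupling_eq_label_sums[OF G I ij(4,5) ne] coupling_value_def Let_def table_entry_encode V
    by (intro arg_cong2[of _ _ _ _ "(+)"] arg_cong2[of _ _ _ _ "(*)"] sum.cong refl)
       (use ij vs(1) in \<open>auto simp: adj_encode L nth_eq_iff_index_eq\<close>)
qed

lemma efficiently_computable_coupling: "efficiently_computable coupling"
proof -
  obtain c p where c: "\<And>T \<beta> \<gamma>. \<exists>t s. exec T [cos \<beta>, sin \<beta>, cos \<gamma>, sin \<gamma>] c init_memory t s \<and>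
    t \<le> poly p (table_entry T 0 0) \<and> snd s 0 = coupling_value T \<beta> \<gamma>"
    using coupling_value_program by blast
  show ?thesis
    unfolding efficiently_computable_def
  proof (intro exI[of _ c] exI[of _ p] allI impI, elim conjE)
    fix V :: "'a set" and E V0 and \<beta> \<gamma> :: real and vs :: "'a list" and i j
    assume *: "cubic_graph V E" "two_independent V E V0" "distinct vs" "set vs = V" "i < length vs" "j < length vs"
      "i \<noteq> j" "vs ! i \<in> V0" "vs ! j \<in> V0"
    \<comment> \<open>The table stores \<open>length vs\<close>, so the time bound becomes one in
      \<open>card V\<close>.\<close>
    have "card V = length vs" using *(3,4) distinct_card by blast
    then show "\<exists>t s. exec (encode vs E V0 i j) [cos \<beta>, sin \<beta>, cos \<gamma>, sin \<gamma>] c init_memory t s \<and>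
        t \<le> poly p (card V) \<and> snd s 0 = coupling V E V0 \<beta> \<gamma> {vs ! i, vs ! j}"
      using c[of "encode vs E V0 i j" \<beta> \<gamma>] by (simp only: coupling_eq_coupling_value[OF *] table_entry_encode)
  qed
qed

theorem proposition22:
  "\<exists>J :: 'a set \<Rightarrow> 'a set set \<Rightarrow> 'a set \<Rightarrow> real \<Rightarrow> real \<Rightarrow> 'a set \<Rightarrow> real.
     efficiently_computable J \<and>
     (\<forall>V E V0 \<beta> \<gamma>. cubic_graph V E \<longrightarrow> two_independent V E V0 \<longrightarrow>
        (\<forall>\<sigma> :: 'a \<Rightarrow> real. (\<forall>v\<in>V0. \<sigma> v \<in> {-1, 1}) \<longrightarrow>
           ket_norm V (meas_proj V0 \<sigma> (qaoa1 V E \<beta> \<gamma>)) \<noteq> 0 \<and>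
           expval V (qaoa1 V E \<beta> \<gamma>) (meas_proj V0 \<sigma> \<circ> maxcut E \<circ> meas_proj V0 \<sigma>)
             / complex_of_real ((ket_norm V (meas_proj V0 \<sigma> (qaoa1 V E \<beta> \<gamma>)))\<^sup>2)
           = expval V (qaoa1 V E \<beta> \<gamma>) (maxcut E)
             + complex_of_real (\<Sum>q | q \<subseteq> V0 \<and> card q = 2. J V E V0 \<beta> \<gamma> q * (\<Prod>v\<in>q. \<sigma> v))) \<and>
        (\<forall>v\<in>V0. \<forall>w\<in>V0. v \<noteq> w \<longrightarrow>
           complex_of_real (J V E V0 \<beta> \<gamma> {v, w})
           = - (1 / 2) * (\<Sum>e | e \<in> E \<and> edge_dist E v e \<le> 2 \<and> edge_dist E w e \<le> 2.
               expval V (qaoa1 V E \<beta> \<gamma>) (edge_ZZ e \<circ> pauli_Z v \<circ> pauli_Z w))))"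
proof (intro exI[of _ coupling] conjI allI impI ballI)
  show "efficiently_computable (coupling :: 'a set \<Rightarrow> _)"
    by (rule efficiently_computable_coupling)
next
  fix V :: "'a set" and E V0 \<beta> \<gamma> and \<sigma> :: "'a \<Rightarrow> real"
  assume *: "cubic_graph V E" "two_independent V E V0" "\<forall>v\<in>V0. \<sigma> v \<in> {-1, 1}"
  \<comment> \<open>The squared norm is a negative power of 2, so it is not zero.\<close>
  show "ket_norm V (meas_proj V0 \<sigma> (qaoa1 V E \<beta> \<gamma>)) \<noteq> 0"
    using ket_norm_meas_proj[OF *, of \<beta> \<gamma>] by auto
qed (rule conditional_expectation coupling_pair; assumption)+

end
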